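(* Let $X_{\mathcal M}$ be a hypergraph PIN model on a $t$-uniform hypergraph $\mathcal H=(\mathcal M,\mathcal E)$, and suppose the source is Type $\mathcal S$. Then $$\mathrm{CI}(X_{\mathcal M})=\mathrm{CI}_W(X_{\mathcal M})=H(X_{\mathcal M})=|\mathcal E|,$$ and consequently $$R_{\mathrm{SK}}=R_{\mathrm{CO}}=\frac{m-t}{m-1}\,|\mathcal E|.$$
   Context: Setup. Let $\mathcal M=\{1,\dots,m\}$, $m\ge2$; $X_{\mathcal M}$ is a source with finite alphabets; $X^n_{\mathcal M}$ consists of $n$ i.i.d. copies; $X_A=(X_i:i\in A)$. Logs and entropies are base 2. Hypergraph PIN model. Given a hypergraph $\mathcal H=(\mathcal M,\mathcal E)$, with $\mathcal E$ a finite multiset of subsets (hyperedges) of $\mathcal M$, let $\mathcal E^{(n)}$ be the multiset with $n$ copies of each element of $\mathcal E$. To each $e\in\mathcal E^{(n)}$ attach a Bernoulli(1/2) random variable $\xi_e$, all mutually independent. Set $X^n_i=(\xi_e:e\in\mathcal E^{(n)},\ i\in e)$. $\mathcal H$ is $t$-uniform if $|e|=t$ for all $e\in\mathcal E$. Interactive communication, CR, SK. An interactive communication $\mathbf F$ is a finite sequence of transmissions; each is sent by some terminal $i$ and is a deterministic function of $X_i^n$ and earlier transmissions. Its range is $\mathcal F$. A CR $\mathbf J$ obtained from $\mathbf F$ is a sequence of functions of $X^n_{\mathcal M}$ such that for every $0<\epsilon<1$ and large $n$, there are $J_i(X^n_i,\mathbf F)$ with $\Pr[J_1=\cdots=J_m=\mathbf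 J]\ge1-\epsilon$. An SK is a CR $\mathbf K$ from $\mathbf F$ with $I(\mathbf K;\mathbf F)\le\epsilon$ for large $n$, for every $\epsilon>0$. Multipartite information. $\Delta(\mathcal P)=\frac{1}{|\mathcal P|-1}[\sum_{A\in\mathcal P}H(X_A)-H(X_{\mathcal M})]$ for partitions $\mathcal P$ with $|\mathcal P|\ge2$, and $\mathbf I(X_{\mathcal M})=\min_{\mathcal P}\Delta(\mathcal P)$. The source is Type $\mathcal S$ if the singleton partition $\mathcal S=\{\{1\},\dots,\{m\}\}$ attains this minimum. Communication rates. $R_{\mathrm{CO}}=\min\{\sum_{i}R_i:\sum_{i\in B}R_i\ge H(X_B|X_{B^c})\ \forall\emptyset\ne B\subsetneq\mathcal M\}$. $R_{\mathrm{SK}}$ is the infimum of $R\ge0$ such that for every $\epsilon>0$ and large $n$ there exist $\mathbf F$ with $\frac1n\log|\mathcal F|\le R+\epsilon$ and an SK $\mathbf K$ from $\mathbf F$ with $\frac1nH(\mathbf K)\ge\mathbf I(X_{\mathcal M})-\epsilon$. Common information. $\mathbf I(X^n_{\mathcal M}|\mathbf L)=\max_{\mathcal P^*}\frac{1}{|\mathcal P^*|-1}[\sum_{A\in\mathcal P^*}H(X^n_A|\mathbf L)-H(X^n_{\mathcal M}|\mathbf L)]$, with the maximum over minimizers $\mathcal P^*$ of $\Delta$. A $\mathrm{CI}_W$ is a sequence of functions $\mathbf L^{(n)}(X^n_{\mathcal M})$ with $\frac1n\mathbf I(X^n_{\mathcal M}|\mathbf L^{(n)})\to0$; a CI is a $\mathrm{CI}_W$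 of the form $(\mathbf J,\mathbf F)$ with $\mathbf J$ a CR from $\mathbf F$. $\mathrm{CI}_W(X_{\mathcal M})$ (resp. $\mathrm{CI}(X_{\mathcal M})$) is the infimum of $R$ such that some $\mathrm{CI}_W$ (resp. CI) $\mathbf L$ has $\frac1nH(\mathbf L)\le R+\epsilon$ for large $n$, for all $\epsilon>0$.
   Formalization: The formal theorem assumes t ≥ 2; for t = 1 with nonempty E every source is Type S but CI_W = 0 ≠ |E| and R_SK = 0 ≠ R_CO, and for t = 0 with nonempty E one has H(X_M) = 0 ≠ |E|, so the claim as stated fails there. *)

theory Defs
  imports Complex_Main "HOL-Library.Disjoint_Sets"
begin

text \<open>Hypergraph PIN model.  The hypergraph on terminals {1..m} is given by a list es of
hyperedges (a list represents the finite multiset E).  The n-letter source is determined by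
the independent fair bits xi_(e,j), for e < length es (edge index) and j < n (copy index).
The sample space is the set of all assignments of bits to these indices (other indices are
fixed to False), equipped with the uniform distribution.\<close>

type_synonym outcome = "nat \<times> nat \<Rightarrow> bool"

definition Idx :: "nat set list \<Rightarrow> nat \<Rightarrow> (nat \<times> nat) set" where
  "Idx es n = {0..<length es} \<times> {0..<n}"

definition Omega :: "nat set list \<Rightarrow> nat \<Rightarrow> outcome set" where
  "Omega es n = {\<omega>. \<forall>x. x \<notin> Idx es n \<longrightarrow> \<omega> x = False}"

definition Pr :: "nat set list \<Rightarrow> nat \<Rightarrow> (outcome \<Rightarrow> bool) \<Rightarrow> real" where
  "Pr es n P = real (card {\<omega> \<in> Omega es n. P \<omega>}) / real (card (Omega es n))"

definition ent :: "nat set list \<Rightarrow> nat \<Rightarrow> (outcome \<Rightarrow> 'b) \<Rightarrow> real" where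
  "ent es n f = (\<Sum>y \<in> f ` Omega es n.
      - Pr es n (\<lambda>\<omega>. f \<omega> = y) * log 2 (Pr es n (\<lambda>\<omega>. f \<omega> = y)))"

definition cond_ent :: "nat set list \<Rightarrow> nat \<Rightarrow> (outcome \<Rightarrow> 'b) \<Rightarrow> (outcome \<Rightarrow> 'c) \<Rightarrow> real" where
  "cond_ent es n f g = (\<Sum>(x, y) \<in> (\<lambda>\<omega>. (f \<omega>, g \<omega>)) ` Omega es n.
      - Pr es n (\<lambda>\<omega>. f \<omega> = x \<and> g \<omega> = y)
        * log 2 (Pr es n (\<lambda>\<omega>. f \<omega> = x \<and> g \<omega> = y) / Pr es n (\<lambda>\<omega>. g \<omega> = y)))"

definition mutual_info :: "nat set list \<Rightarrow> nat \<Rightarrow> (outcome \<Rightarrow> 'b) \<Rightarrow> (outcome \<Rightarrow> 'c) \<Rightarrow> real" where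
  "mutual_info es n f g = ent es n f - cond_ent es n f g"

text \<open>X^n_i = (xi_e : e in E^(n), i in e) and X^n_A = (X^n_i : i in A).\<close>
definition Xi :: "nat set list \<Rightarrow> nat \<Rightarrow> nat \<Rightarrow> outcome \<Rightarrow> outcome" where
  "Xi es n i \<omega> = (\<lambda>x. if x \<in> Idx es n \<and> i \<in> es ! fst x then \<omega> x else False)"

definition XA :: "nat set list \<Rightarrow> nat \<Rightarrow> nat set \<Rightarrow> outcome \<Rightarrow> (nat \<Rightarrow> outcome)" where
  "XA es n A \<omega> = (\<lambda>i. if i \<in> A then Xi es n i \<omega> else (\<lambda>_. False))"

definition fun_of :: "nat set list \<Rightarrow> nat \<Rightarrow> (outcome \<Rightarrow> 'b) \<Rightarrow> (outcome \<Rightarrow> 'c) \<Rightarrow> bool" where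
  "fun_of es n f g \<longleftrightarrow> (\<exists>h. \<forall>\<omega> \<in> Omega es n. f \<omega> = h (g \<omega>))"

definition terminals :: "nat \<Rightarrow> nat set" where
  "terminals m = {1..m}"

definition interactive_comm :: "nat \<Rightarrow> nat set list \<Rightarrow> nat \<Rightarrow> (outcome \<Rightarrow> nat list) \<Rightarrow> bool" where
  "interactive_comm m es n F \<longleftrightarrow>
     (\<exists>r s. (\<forall>\<omega> \<in> Omega es n. length (F \<omega>) = r) \<and>
        (\<forall>j<r. s j \<in> terminals m \<and>
           (\<exists>h. \<forall>\<omega> \<in> Omega es n. F \<omega> ! j = h (Xi es n (s j) \<omega>) (take j (F \<omega>)))))"

definition range_size :: "nat set list \<Rightarrow> nat \<Rightarrow> (outcome \<Rightarrow> nat list) \<Rightarrow> nat" where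
  "range_size es n F = card (F ` Omega es n)"

definition is_CR :: "nat \<Rightarrow> nat set list \<Rightarrow> (nat \<Rightarrow> outcome \<Rightarrow> 'j) \<Rightarrow> (nat \<Rightarrow> outcome \<Rightarrow> nat list) \<Rightarrow> bool" where
  "is_CR m es J F \<longleftrightarrow>
     (\<forall>n. interactive_comm m es n (F n)) \<and>
     (\<forall>n. fun_of es n (J n) (XA es n (terminals m))) \<and>
     (\<forall>\<epsilon>::real. 0 < \<epsilon> \<and> \<epsilon> < 1 \<longrightarrow>
        (\<forall>\<^sub>F n in sequentially. \<exists>g :: nat \<Rightarrow> outcome \<Rightarrow> nat list \<Rightarrow> 'j.
           Pr es n (\<lambda>\<omega>. \<forall>i \<in> terminals m. g i (Xi es n i \<omega>) (F n \<omega>) = J n \<omega>) \<ge> 1 - \<epsilon>))"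

definition is_SK :: "nat \<Rightarrow> nat set list \<Rightarrow> (nat \<Rightarrow> outcome \<Rightarrow> 'k) \<Rightarrow> (nat \<Rightarrow> outcome \<Rightarrow> nat list) \<Rightarrow> bool" where
  "is_SK m es K F \<longleftrightarrow> is_CR m es K F \<and>
     (\<forall>\<epsilon>::real. 0 < \<epsilon> \<longrightarrow> (\<forall>\<^sub>F n in sequentially. mutual_info es n (K n) (F n) \<le> \<epsilon>))"

definition partitions :: "nat \<Rightarrow> nat set set set" where
  "partitions m = {P. partition_on (terminals m) P \<and> card P \<ge> 2}"

definition Delta :: "nat set list \<Rightarrow> nat \<Rightarrow> nat set set \<Rightarrow> real" where
  "Delta es m P = ((\<Sum>A \<in> P. ent es 1 (XA es 1 A)) - ent es 1 (XA es 1 (terminals m)))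
                  / (real (card P) - 1)"

definition MMI :: "nat set list \<Rightarrow> nat \<Rightarrow> real" where
  "MMI es m = Min (Delta es m ` partitions m)"

definition singleton_partition :: "nat \<Rightarrow> nat set set" where
  "singleton_partition m = (\<lambda>i. {i}) ` terminals m"

definition typeS :: "nat set list \<Rightarrow> nat \<Rightarrow> bool" where
  "typeS es m \<longleftrightarrow> Delta es m (singleton_partition m) = MMI es m"

definition cond_MMI :: "nat set list \<Rightarrow> nat \<Rightarrow> nat \<Rightarrow> (outcome \<Rightarrow> 'l) \<Rightarrow> real" where
  "cond_MMI es m n L = Max ((\<lambda>P. ((\<Sum>A \<in> P. cond_ent es n (XA es n A) L)
        - cond_ent es n (XA es n (terminals m)) L) / (real (card P) - 1))
      ` {P \<in> partitions m. Delta es m P = MMI es m})"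

definition is_CIW :: "nat \<Rightarrow> nat set list \<Rightarrow> (nat \<Rightarrow> outcome \<Rightarrow> 'l) \<Rightarrow> bool" where
  "is_CIW m es L \<longleftrightarrow> (\<forall>n. fun_of es n (L n) (XA es n (terminals m))) \<and>
     ((\<lambda>n. cond_MMI es m n (L n) / real n) \<longlonglongrightarrow> 0)"

definition CIW_rate :: "nat set list \<Rightarrow> nat \<Rightarrow> real" where
  "CIW_rate es m = Inf {R. \<exists>L :: nat \<Rightarrow> outcome \<Rightarrow> nat. is_CIW m es L \<and>
      (\<forall>\<epsilon>>0. \<forall>\<^sub>F n in sequentially. ent es n (L n) / real n \<le> R + \<epsilon>)}"

definition CI_rate :: "nat set list \<Rightarrow> nat \<Rightarrow> real" where
  "CI_rate es m = Inf {R. \<exists>(J :: nat \<Rightarrow> outcome \<Rightarrow> nat) F. is_CR m es J F \<and>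
      is_CIW m es (\<lambda>n \<omega>. (J n \<omega>, F n \<omega>)) \<and>
      (\<forall>\<epsilon>>0. \<forall>\<^sub>F n in sequentially. ent es n (\<lambda>\<omega>. (J n \<omega>, F n \<omega>)) / real n \<le> R + \<epsilon>)}"

definition R_CO :: "nat set list \<Rightarrow> nat \<Rightarrow> real" where
  "R_CO es m = Inf {(\<Sum>i \<in> terminals m. R i) | R :: nat \<Rightarrow> real.
      \<forall>B. B \<noteq> {} \<and> B \<subset> terminals m \<longrightarrow>
        (\<Sum>i \<in> B. R i) \<ge> cond_ent es 1 (XA es 1 B) (XA es 1 (terminals m - B))}"

definition R_SK :: "nat set list \<Rightarrow> nat \<Rightarrow> real" where
  "R_SK es m = Inf {R. R \<ge> 0 \<and>
      (\<forall>\<epsilon>>0. \<exists>(K :: nat \<Rightarrow> outcome \<Rightarrow> nat) F. is_SK m es K F \<and>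
         (\<forall>\<^sub>F n in sequentially.
            log 2 (real (range_size es n (F n))) / real n \<le> R + \<epsilon> \<and>
            ent es n (K n) / real n \<ge> MMI es m - \<epsilon>))}"

end

theory Submission
  imports Defs
begin

text \<open>
  The probability space is uniform, so entropies are averages of logarithms of fibre sizes.  In a
  \<open>t\<close>-uniform hypergraph every bit is seen by exactly \<open>t\<close> terminals; a conditional
  Shearer inequality therefore gives
  \<open>\<Sum>\<^sub>i H(X\<^sub>i | L) \<ge> t H(X | L)\<close> for every function \<open>L\<close> of the source.  At the
  singleton partition this bounds \<open>(t - 1) H(X | L)\<close> by \<open>(m - 1) I(X | L)\<close>, so a
  \<open>CI\<^sub>W\<close> must carry asymptotically all of \<open>H(X)\<close>.

  For the converse on the communication rate, Shearer's inequality is applied to \<open>L = (K, F)\<close>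
  and combined with Fano's inequality for \<open>H(K | X\<^sub>i, F)\<close> and with
  \<open>\<Sum>\<^sub>i I(X\<^sub>i ; F) \<ge> H(F)\<close>, which holds because each transmission is a function of one
  \<open>X\<^sub>i\<close> and the past.  The result is
  \<open>(m - t) H(K | F) \<le> (t - 1) H(F) + o(n)\<close>.

  For achievability, random parity checks at rates inside the omniscience region let every
  terminal recover \<open>X\<close> without error.  Such an \<open>F\<close> is additive, so all its fibres have the
  same size, and the position of the outcome within its fibre is a key independent of \<open>F\<close>.
\<close>

section \<open>Entropy via fibre sizes\<close>

definition supported :: "(nat \<times> nat) set \<Rightarrow> outcome set" where
  "supported T = {\<omega>. \<forall>x. x \<notin> T \<longrightarrow> \<not> \<omega> x}"

text \<open>Addition of vectors over the field with two elements; every vector is its own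
  negative.\<close>

definition vadd :: "outcome \<Rightarrow> outcome \<Rightarrow> outcome" where
  "vadd \<omega> \<omega>' = (\<lambda>x. \<omega> x \<noteq> \<omega>' x)"

definition restr :: "(nat \<times> nat) set \<Rightarrow> outcome \<Rightarrow> outcome" where
  "restr T \<omega> = (\<lambda>x. x \<in> T \<and> \<omega> x)"

text \<open>Indexed by a point rather than by a value, so that entropies become averages of
  \<open>log 2 (fib es n f \<omega>)\<close> over all outcomes and can be compared outcome by
  outcome.\<close>

definition fib :: "nat set list \<Rightarrow> nat \<Rightarrow> (outcome \<Rightarrow> 'b) \<Rightarrow> outcome \<Rightarrow> real" where
  "fib es n f \<omega> = real (card {\<omega>' \<in> Omega es n. f \<omega>' = f \<omega>})"

lemma Omega_eq_supported: "Omega es n = supported (Idx es n)"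
  by (simp add: Omega_def supported_def)

lemma finite_Idx [simp]: "finite (Idx es n)"
  by (simp add: Idx_def)

lemma card_Idx: "card (Idx es n) = length es * n"
  by (simp add: Idx_def)

lemma bij_betw_supported: "bij_betw (\<lambda>A x. x \<in> A) (Pow T) (supported T)"
proof (rule bij_betw_byWitness[where f' = "\<lambda>\<omega>. {x. \<omega> x}"])
qed (auto simp: supported_def)

lemma card_supported: "finite T \<Longrightarrow> card (supported T) = 2 ^ card T"
  using bij_betw_same_card[OF bij_betw_supported, of T] by (simp add: card_Pow)

lemma finite_supported: "finite T \<Longrightarrow> finite (supported T)"
  using bij_betw_finite[OF bij_betw_supported, of T] by simp

lemma finite_Omega [simp]: "finite (Omega es n)"
  by (simp add: Omega_eq_supported finite_supported)

lemma card_Omega: "card (Omega es n) = 2 ^ (length es * n)"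
  by (simp add: Omega_eq_supported card_supported card_Idx)

lemma card_Omega_pos [simp]: "card (Omega es n) > 0"
  by (simp add: card_Omega)

lemma zero_in_Omega [simp]: "(\<lambda>_. False) \<in> Omega es n"
  by (simp add: Omega_def)

lemma Omega_nonempty [simp]: "Omega es n \<noteq> {}"
  using zero_in_Omega by blast

lemma vadd_in_Omega: "\<omega> \<in> Omega es n \<Longrightarrow> \<omega>' \<in> Omega es n \<Longrightarrow> vadd \<omega> \<omega>' \<in> Omega es n"
  by (auto simp: Omega_def vadd_def)

lemma vadd_vadd [simp]: "vadd \<omega> (vadd \<omega> \<omega>') = \<omega>'"
  by (auto simp: vadd_def)

lemma fib_pos: "\<omega> \<in> Omega es n \<Longrightarrow> fib es n f \<omega> > 0"
  by (auto simp: fib_def card_gt_0_iff)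

lemma fib_le_card: "fib es n f \<omega> \<le> real (card (Omega es n))"
  by (auto simp: fib_def intro!: card_mono)

lemma fib_antimono:
  assumes "\<And>\<omega>'. \<omega>' \<in> Omega es n \<Longrightarrow> f \<omega>' = f \<omega> \<Longrightarrow> g \<omega>' = g \<omega>"
  shows "fib es n f \<omega> \<le> fib es n g \<omega>"
  unfolding fib_def of_nat_le_iff by (rule card_mono) (use assms in \<open>simp, blast\<close>)

text \<open>A value whose fibre has \<open>c\<close> elements has probability \<open>c / N\<close>,
  and each outcome in that fibre accounts for the share \<open>(log 2 N - log 2 c) / N\<close> of
  the entropy. Regrouping the sum from values to outcomes gives the formula.\<close>

lemma ent_eq_fib:
  "ent es n f = log 2 (real (card (Omega es n)))
     - (\<Sum>\<omega>\<in>Omega es n. log 2 (fib es n f \<omega>)) / real (card (Omega es n))"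
proof -
  let ?O = "Omega es n"
  let ?N = "real (card ?O)"
  have N: "?N > 0" by simp
  have "(\<Sum>\<omega>\<in>?O. (log 2 ?N - log 2 (fib es n f \<omega>)) / ?N)
      = (\<Sum>y\<in>f ` ?O. \<Sum>\<omega>\<in>{\<omega>\<in>?O. f \<omega> = y}. (log 2 ?N - log 2 (fib es n f \<omega>)) / ?N)"
    by (rule sum.image_gen) simp
  also have "\<dots> = (\<Sum>y\<in>f ` ?O. - Pr es n (\<lambda>\<omega>. f \<omega> = y) * log 2 (Pr es n (\<lambda>\<omega>. f \<omega> = y)))"
  proof (rule sum.cong[OF refl])
    fix y assume "y \<in> f ` ?O"
    then have "real (card {\<omega>\<in>?O. f \<omega> = y}) > 0" by (auto simp: card_gt_0_iff)
    moreover define c where "c = real (card {\<omega>\<in>?O. f \<omega> = y})"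
    ultimately have c: "c > 0" by simp
    have "(\<Sum>\<omega>\<in>{\<omega>\<in>?O. f \<omega> = y}. (log 2 ?N - log 2 (fib es n f \<omega>)) / ?N)
        = (\<Sum>\<omega>\<in>{\<omega>\<in>?O. f \<omega> = y}. (log 2 ?N - log 2 c) / ?N)"
      by (rule sum.cong) (auto simp: fib_def c_def)
    also have "\<dots> = c * ((log 2 ?N - log 2 c) / ?N)" by (simp add: c_def)
    finally show "(\<Sum>\<omega>\<in>{\<omega>\<in>?O. f \<omega> = y}. (log 2 ?N - log 2 (fib es n f \<omega>)) / ?N)
        = - Pr es n (\<lambda>\<omega>. f \<omega> = y) * log 2 (Pr es n (\<lambda>\<omega>. f \<omega> = y))"
      using c N by (simp add: Pr_def log_divide field_simps flip: c_def)
  qed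
  finally have "ent es n f = (\<Sum>\<omega>\<in>?O. (log 2 ?N - log 2 (fib es n f \<omega>)) / ?N)"
    by (simp add: ent_def)
  also have "\<dots> = (\<Sum>\<omega>\<in>?O. log 2 ?N - log 2 (fib es n f \<omega>)) / ?N"
    by (simp add: sum_divide_distrib)
  finally show ?thesis
    using N by (simp add: sum_subtractf diff_divide_distrib)
qed

lemma log_card_Omega: "log 2 (real (card (Omega es n))) = real (length es) * real n"
  by (simp add: card_Omega log_nat_power)

text \<open>The chain rule. Both sides average, over outcomes, the log ratio of the fibre of
  \<open>g\<close> to the fibre of the pair.\<close>

lemma cond_ent_eq: "cond_ent es n f g = ent es n (\<lambda>\<omega>. (f \<omega>, g \<omega>)) - ent es n g"
proof -
  let ?O = "Omega es n"
  let ?N = "real (card ?O)"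
  let ?p = "\<lambda>\<omega>. (f \<omega>, g \<omega>)"
  have N: "?N > 0" by simp
  have "(\<Sum>\<omega>\<in>?O. (log 2 (fib es n g \<omega>) - log 2 (fib es n ?p \<omega>)) / ?N)
      = (\<Sum>y\<in>?p ` ?O. \<Sum>\<omega>\<in>{\<omega>\<in>?O. ?p \<omega> = y}. (log 2 (fib es n g \<omega>) - log 2 (fib es n ?p \<omega>)) / ?N)"
    by (rule sum.image_gen) simp
  also have "\<dots> = cond_ent es n f g"
    unfolding cond_ent_def
  proof (rule sum.cong[OF refl], clarify)
    fix \<omega>0 assume "\<omega>0 \<in> ?O"
    let ?x = "f \<omega>0" and ?y = "g \<omega>0"
    define b c where "b = real (card {\<omega>\<in>?O. f \<omega> = ?x \<and> g \<omega> = ?y})" and "c = real (card {\<omega>\<in>?O. g \<omega> = ?y})"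
    note bc = this
    have pos: "b > 0" "c > 0"
      using \<open>\<omega>0 \<in> ?O\<close> by (auto simp: card_gt_0_iff bc)
    have "(\<Sum>\<omega>\<in>{\<omega>\<in>?O. ?p \<omega> = (?x, ?y)}. (log 2 (fib es n g \<omega>) - log 2 (fib es n ?p \<omega>)) / ?N)
        = (\<Sum>\<omega>\<in>{\<omega>\<in>?O. f \<omega> = ?x \<and> g \<omega> = ?y}. (log 2 c - log 2 b) / ?N)"
      by (rule sum.cong) (auto simp: fib_def bc)
    also have "\<dots> = b * ((log 2 c - log 2 b) / ?N)" by (simp add: bc)
    finally show "(\<Sum>\<omega>\<in>{\<omega>\<in>?O. ?p \<omega> = (?x, ?y)}. (log 2 (fib es n g \<omega>) - log 2 (fib es n ?p \<omega>)) / ?N)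
        = - Pr es n (\<lambda>\<omega>. f \<omega> = ?x \<and> g \<omega> = ?y)
        * log 2 (Pr es n (\<lambda>\<omega>. f \<omega> = ?x \<and> g \<omega> = ?y) / Pr es n (\<lambda>\<omega>. g \<omega> = ?y))"
      using pos N by (simp add: Pr_def log_divide field_simps flip: bc)
  qed
  finally show ?thesis
    by (simp add: ent_eq_fib sum_subtractf diff_divide_distrib flip: sum_divide_distrib)
qed

text \<open>Here \<open>g\<close> factors through \<open>f\<close>, so fibres of \<open>f\<close>
  lie inside fibres of \<open>g\<close>, and larger fibres mean smaller entropy.\<close>

lemma ent_mono:
  assumes "\<And>\<omega> \<omega>'. \<omega> \<in> Omega es n \<Longrightarrow> \<omega>' \<in> Omega es n \<Longrightarrow> f \<omega> = f \<omega>' \<Longrightarrow> g \<omega> = g \<omega>'"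
  shows "ent es n g \<le> ent es n f"
proof -
  have "(\<Sum>\<omega>\<in>Omega es n. log 2 (fib es n f \<omega>)) \<le> (\<Sum>\<omega>\<in>Omega es n. log 2 (fib es n g \<omega>))"
  proof (rule sum_mono)
    fix \<omega> assume w: "\<omega> \<in> Omega es n"
    have "fib es n f \<omega> \<le> fib es n g \<omega>"
      by (rule fib_antimono) (use assms w in blast)
    then show "log 2 (fib es n f \<omega>) \<le> log 2 (fib es n g \<omega>)"
      using fib_pos[OF w, of f] fib_pos[OF w, of g] by simp
  qed
  then show ?thesis by (simp add: ent_eq_fib divide_right_mono)
qed

text \<open>Entropy depends only on the partition of the sample space into fibres. This is how
  tuples are reordered, merged or stripped of redundant components below.\<close>

lemma ent_cong:
  assumes "\<And>\<omega> \<omega>'. \<omega> \<in> Omega es n \<Longrightarrow> \<omega>' \<in> Omega es n \<Longrightarrow> f \<omega> = f \<omega>' \<longleftrightarrow> g \<omega> = g \<omega>'"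
  shows "ent es n f = ent es n g"
  by (rule antisym; rule ent_mono) (use assms in blast)+

section \<open>Submodularity and the cardinality bound\<close>

lemma sum_fib_eq:
  assumes "finite A"
  shows "(\<Sum>y\<in>f ` A. real (card {\<omega>\<in>A. f \<omega> = y})) = real (card A)"
  using sum.image_gen[OF assms, of "\<lambda>_. 1::real" f] by simp

text \<open>Divided by the number of outcomes, the sum is the mean of p(x,z) p(y,z) / (p(x,y,z)
  p(z)). Grouping by attained triples cancels p(x,y,z); extending the sum to all pairs x, y that
  occur with z makes it factor into marginals.\<close>

lemma sum_fib_ratio:
  "(\<Sum>\<omega>\<in>Omega es n. fib es n (\<lambda>\<omega>. (f \<omega>, h \<omega>)) \<omega> * fib es n (\<lambda>\<omega>. (g \<omega>, h \<omega>)) \<omega>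
      / (fib es n (\<lambda>\<omega>. (f \<omega>, g \<omega>, h \<omega>)) \<omega> * fib es n h \<omega>)) \<le> real (card (Omega es n))"
proof -
  let ?O = "Omega es n"
  let ?p = "\<lambda>\<omega>. (f \<omega>, g \<omega>, h \<omega>)"
  let ?c = "\<lambda>z. real (card {\<omega>\<in>?O. h \<omega> = z})"
  let ?a = "\<lambda>x z. real (card {\<omega>\<in>?O. f \<omega> = x \<and> h \<omega> = z})"
  let ?b = "\<lambda>y z. real (card {\<omega>\<in>?O. g \<omega> = y \<and> h \<omega> = z})"
  let ?X = "\<lambda>z. f ` {\<omega>\<in>?O. h \<omega> = z}"
  let ?Y = "\<lambda>z. g ` {\<omega>\<in>?O. h \<omega> = z}"
  have "(\<Sum>\<omega>\<in>?O. fib es n (\<lambda>\<omega>. (f \<omega>, h \<omega>)) \<omega> * fib es n (\<lambda>\<omega>. (g \<omega>, h \<omega>)) \<omega>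
      / (fib es n ?p \<omega> * fib es n h \<omega>))
      = (\<Sum>v\<in>?p ` ?O. \<Sum>\<omega>\<in>{\<omega>\<in>?O. ?p \<omega> = v}. fib es n (\<lambda>\<omega>. (f \<omega>, h \<omega>)) \<omega> * fib es n (\<lambda>\<omega>. (g \<omega>, h \<omega>)) \<omega>
      / (fib es n ?p \<omega> * fib es n h \<omega>))"
    by (rule sum.image_gen) simp
  also have "\<dots> = (\<Sum>(x, y, z)\<in>?p ` ?O. ?a x z * ?b y z / ?c z)"
  proof (rule sum.cong[OF refl], clarify)
    fix \<omega>0 assume w: "\<omega>0 \<in> ?O"
    let ?S = "{\<omega>\<in>?O. ?p \<omega> = ?p \<omega>0}"
    define s where "s = real (card ?S)"
    have s: "s > 0" using w by (auto simp: card_gt_0_iff s_def)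
    have "(\<Sum>\<omega>\<in>?S. fib es n (\<lambda>\<omega>. (f \<omega>, h \<omega>)) \<omega> * fib es n (\<lambda>\<omega>. (g \<omega>, h \<omega>)) \<omega>
        / (fib es n ?p \<omega> * fib es n h \<omega>))
      = (\<Sum>\<omega>\<in>?S. ?a (f \<omega>0) (h \<omega>0) * ?b (g \<omega>0) (h \<omega>0) / (s * ?c (h \<omega>0)))"
      by (rule sum.cong) (auto simp: fib_def s_def)
    also have "\<dots> = s * (?a (f \<omega>0) (h \<omega>0) * ?b (g \<omega>0) (h \<omega>0) / (s * ?c (h \<omega>0)))"
      by (simp only: sum_constant s_def)
    finally show "(\<Sum>\<omega>\<in>?S. fib es n (\<lambda>\<omega>. (f \<omega>, h \<omega>)) \<omega> * fib es n (\<lambda>\<omega>. (g \<omega>, h \<omega>)) \<omega>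
        / (fib es n ?p \<omega> * fib es n h \<omega>)) = ?a (f \<omega>0) (h \<omega>0) * ?b (g \<omega>0) (h \<omega>0) / ?c (h \<omega>0)"
      using s by simp
  qed
  \<comment> \<open>The only inequality: x and y may each occur with z although the triple does not.
    The added terms are nonnegative.\<close>
  also have "\<dots> \<le> (\<Sum>(x, y, z)\<in>(\<lambda>(z, x, y). (x, y, z)) ` (SIGMA z:h ` ?O. ?X z \<times> ?Y z). ?a x z * ?b y z / ?c z)"
    by (rule sum_mono2) (auto intro!: rev_image_eqI)
  also have "\<dots> = (\<Sum>(z, x, y)\<in>(SIGMA z:h ` ?O. ?X z \<times> ?Y z). ?a x z * ?b y z / ?c z)"
    by (subst sum.reindex) (auto simp: inj_on_def case_prod_unfold)
  also have "\<dots> = (\<Sum>z\<in>h ` ?O. \<Sum>(x, y)\<in>?X z \<times> ?Y z. ?a x z * ?b y z / ?c z)"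
    by (subst sum.Sigma) auto
  also have "\<dots> = (\<Sum>z\<in>h ` ?O. (\<Sum>x\<in>?X z. ?a x z) * (\<Sum>y\<in>?Y z. ?b y z) / ?c z)"
    by (simp add: sum_product sum.cartesian_product sum_divide_distrib case_prod_unfold)
  also have "\<dots> = (\<Sum>z\<in>h ` ?O. ?c z)"
  proof (rule sum.cong[OF refl])
    fix z assume "z \<in> h ` ?O"
    then have c: "?c z > 0" by (auto simp: card_gt_0_iff)
    have "(\<Sum>x\<in>?X z. ?a x z) = ?c z" "(\<Sum>y\<in>?Y z. ?b y z) = ?c z"
      using sum_fib_eq[of "{\<omega>\<in>?O. h \<omega> = z}" f] sum_fib_eq[of "{\<omega>\<in>?O. h \<omega> = z}" g]
      by (simp_all add: conj_ac)
    then show "(\<Sum>x\<in>?X z. ?a x z) * (\<Sum>y\<in>?Y z. ?b y z) / ?c z = ?c z"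
      using c by simp
  qed
  also have "\<dots> = real (card ?O)" by (rule sum_fib_eq) simp
  finally show ?thesis .
qed

text \<open>Nonnegativity of the conditional mutual information of \<open>f\<close> and
  \<open>g\<close> given \<open>h\<close>: the bound \<open>ln r \<le> r - 1\<close> is applied to
  the ratio whose mean \<open>sum_fib_ratio\<close> bounds by 1.\<close>

lemma ent_submodular:
  "ent es n (\<lambda>\<omega>. (f \<omega>, g \<omega>, h \<omega>)) + ent es n h
     \<le> ent es n (\<lambda>\<omega>. (f \<omega>, h \<omega>)) + ent es n (\<lambda>\<omega>. (g \<omega>, h \<omega>))"
proof -
  let ?O = "Omega es n"
  let ?N = "real (card ?O)"
  let ?r = "\<lambda>\<omega>. fib es n (\<lambda>\<omega>. (f \<omega>, h \<omega>)) \<omega> * fib es n (\<lambda>\<omega>. (g \<omega>, h \<omega>)) \<omega>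
      / (fib es n (\<lambda>\<omega>. (f \<omega>, g \<omega>, h \<omega>)) \<omega> * fib es n h \<omega>)"
  have pos: "?r \<omega> > 0" if "\<omega> \<in> ?O" for \<omega>
    by (intro divide_pos_pos mult_pos_pos fib_pos that)
  have "(\<Sum>\<omega>\<in>?O. ln (?r \<omega>)) \<le> (\<Sum>\<omega>\<in>?O. ?r \<omega> - 1)"
    by (intro sum_mono ln_le_minus_one pos)
  also have "\<dots> \<le> 0" using sum_fib_ratio[of es n f h g] by (simp add: sum_subtractf)
  finally have "(\<Sum>\<omega>\<in>?O. log 2 (?r \<omega>)) \<le> 0"
    by (simp add: log_def divide_le_0_iff flip: sum_divide_distrib)
  also have "(\<Sum>\<omega>\<in>?O. log 2 (?r \<omega>)) = (\<Sum>\<omega>\<in>?O. log 2 (fib es n (\<lambda>\<omega>. (f \<omega>, h \<omega>)) \<omega>)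
      + log 2 (fib es n (\<lambda>\<omega>. (g \<omega>, h \<omega>)) \<omega>) - log 2 (fib es n (\<lambda>\<omega>. (f \<omega>, g \<omega>, h \<omega>)) \<omega>)
      - log 2 (fib es n h \<omega>))"
  proof (rule sum.cong[OF refl])
    fix \<omega> assume w: "\<omega> \<in> ?O"
    show "log 2 (?r \<omega>) = log 2 (fib es n (\<lambda>\<omega>. (f \<omega>, h \<omega>)) \<omega>)
      + log 2 (fib es n (\<lambda>\<omega>. (g \<omega>, h \<omega>)) \<omega>) - log 2 (fib es n (\<lambda>\<omega>. (f \<omega>, g \<omega>, h \<omega>)) \<omega>)
      - log 2 (fib es n h \<omega>)"
      using fib_pos[OF w, of "\<lambda>\<omega>. (f \<omega>, h \<omega>)"] fib_pos[OF w, of "\<lambda>\<omega>. (g \<omega>, h \<omega>)"]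
        fib_pos[OF w, of "\<lambda>\<omega>. (f \<omega>, g \<omega>, h \<omega>)"] fib_pos[OF w, of h]
      by (simp add: log_divide log_mult)
  qed
  finally have *: "(\<Sum>\<omega>\<in>?O. log 2 (fib es n (\<lambda>\<omega>. (f \<omega>, h \<omega>)) \<omega>)) + (\<Sum>\<omega>\<in>?O. log 2 (fib es n (\<lambda>\<omega>. (g \<omega>, h \<omega>)) \<omega>))
     \<le> (\<Sum>\<omega>\<in>?O. log 2 (fib es n (\<lambda>\<omega>. (f \<omega>, g \<omega>, h \<omega>)) \<omega>)) + (\<Sum>\<omega>\<in>?O. log 2 (fib es n h \<omega>))"
    by (simp add: sum.distrib sum_subtractf)
  show ?thesis
    using divide_right_mono[OF *, of ?N] by (simp add: ent_eq_fib add_divide_distrib)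
qed

lemma ent_const [simp]: "ent es n (\<lambda>_. c) = 0"
  by (simp add: ent_eq_fib fib_def)

lemma ent_pair_le: "ent es n (\<lambda>\<omega>. (f \<omega>, g \<omega>)) \<le> ent es n f + ent es n g"
proof -
  have "ent es n (\<lambda>\<omega>. (f \<omega>, g \<omega>, ())) + ent es n (\<lambda>_. ())
     \<le> ent es n (\<lambda>\<omega>. (f \<omega>, ())) + ent es n (\<lambda>\<omega>. (g \<omega>, ()))"
    by (rule ent_submodular)
  moreover have "ent es n (\<lambda>\<omega>. (f \<omega>, g \<omega>, ())) = ent es n (\<lambda>\<omega>. (f \<omega>, g \<omega>))"
    "ent es n (\<lambda>\<omega>. (f \<omega>, ())) = ent es n f" "ent es n (\<lambda>\<omega>. (g \<omega>, ())) = ent es n g"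
    by (rule ent_cong; simp)+
  ultimately show ?thesis by simp
qed

text \<open>Again \<open>ln r \<le> r - 1\<close>, now with \<open>r\<close> the ratio of the
  uniform probability \<open>1 / k\<close> on the range to the actual probability of the value;
  these ratios have mean 1.\<close>

lemma ent_le_log_card: "ent es n f \<le> log 2 (real (card (f ` Omega es n)))"
proof -
  let ?O = "Omega es n"
  let ?N = "real (card ?O)" and ?k = "real (card (f ` ?O))"
  have k: "?k > 0" by (simp add: card_gt_0_iff)
  have "(\<Sum>\<omega>\<in>?O. ?N / (fib es n f \<omega> * ?k)) = (\<Sum>y\<in>f ` ?O. \<Sum>\<omega>\<in>{\<omega>\<in>?O. f \<omega> = y}. ?N / (fib es n f \<omega> * ?k))"
    by (rule sum.image_gen) simp
  also have "\<dots> = (\<Sum>y\<in>f ` ?O. ?N / ?k)"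
  proof (rule sum.cong[OF refl])
    fix y assume "y \<in> f ` ?O"
    then have "real (card {\<omega>\<in>?O. f \<omega> = y}) > 0" by (auto simp: card_gt_0_iff)
    moreover define c where "c = real (card {\<omega>\<in>?O. f \<omega> = y})"
    ultimately have c: "c > 0" by simp
    have "(\<Sum>\<omega>\<in>{\<omega>\<in>?O. f \<omega> = y}. ?N / (fib es n f \<omega> * ?k))
       = (\<Sum>\<omega>\<in>{\<omega>\<in>?O. f \<omega> = y}. ?N / (c * ?k))"
      by (rule sum.cong) (auto simp: fib_def c_def)
    also have "\<dots> = c * (?N / (c * ?k))" by (simp add: c_def)
    finally show "(\<Sum>\<omega>\<in>{\<omega>\<in>?O. f \<omega> = y}. ?N / (fib es n f \<omega> * ?k)) = ?N / ?k"
      using c by simp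
  qed
  also have "\<dots> = ?N" using k by simp
  finally have s: "(\<Sum>\<omega>\<in>?O. ?N / (fib es n f \<omega> * ?k)) = ?N" .
  have "(\<Sum>\<omega>\<in>?O. ln (?N / (fib es n f \<omega> * ?k))) \<le> (\<Sum>\<omega>\<in>?O. ?N / (fib es n f \<omega> * ?k) - 1)"
    by (intro sum_mono ln_le_minus_one divide_pos_pos mult_pos_pos fib_pos k) auto
  also have "\<dots> = 0" using s by (simp add: sum_subtractf)
  finally have "(\<Sum>\<omega>\<in>?O. log 2 (?N / (fib es n f \<omega> * ?k))) \<le> 0"
    by (simp add: log_def divide_le_0_iff flip: sum_divide_distrib)
  also have "(\<Sum>\<omega>\<in>?O. log 2 (?N / (fib es n f \<omega> * ?k)))
     = (\<Sum>\<omega>\<in>?O. log 2 ?N - log 2 (fib es n f \<omega>) - log 2 ?k)"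
  proof (rule sum.cong[OF refl])
    fix \<omega> assume w: "\<omega> \<in> ?O"
    have "?N > 0" by simp
    then show "log 2 (?N / (fib es n f \<omega> * ?k)) = log 2 ?N - log 2 (fib es n f \<omega>) - log 2 ?k"
      using fib_pos[OF w, of f] k by (simp add: log_divide log_mult)
  qed
  finally have *: "?N * log 2 ?N - (\<Sum>\<omega>\<in>?O. log 2 (fib es n f \<omega>)) \<le> ?N * log 2 ?k"
    by (simp add: sum_subtractf)
  then show ?thesis
    by (simp add: ent_eq_fib field_simps)
qed

text \<open>The trace of linearity that matters: two outcomes have the same image exactly when their
  difference lies in the kernel. It is phrased through equality of values because the codomain
  carries no algebraic structure.\<close>

definition additive_on :: "nat set list \<Rightarrow> nat \<Rightarrow> (outcome \<Rightarrow> 'b) \<Rightarrow> bool" where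
  "additive_on es n f \<longleftrightarrow> (\<forall>\<omega>\<in>Omega es n. \<forall>\<omega>'\<in>Omega es n. f \<omega> = f \<omega>' \<longleftrightarrow> f (vadd \<omega> \<omega>') = f (\<lambda>_. False))"

text \<open>Translation by \<open>\<omega>\<close> is an involution that exchanges the fibre through
  \<open>\<omega>\<close> with the kernel.\<close>

lemma card_fibre_additive:
  assumes "additive_on es n f" "\<omega> \<in> Omega es n"
  shows "card {\<omega>' \<in> Omega es n. f \<omega>' = f \<omega>} = card {d \<in> Omega es n. f d = f (\<lambda>_. False)}"
proof (rule bij_betw_same_card[of "vadd \<omega>"], rule bij_betw_byWitness[where f' = "vadd \<omega>"])
  show "vadd \<omega> ` {\<omega>' \<in> Omega es n. f \<omega>' = f \<omega>} \<subseteq> {d \<in> Omega es n. f d = f (\<lambda>_. False)}"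
  proof clarify
    fix \<omega>' assume w: "\<omega>' \<in> Omega es n" "f \<omega>' = f \<omega>"
    have "f \<omega> = f \<omega>' \<longleftrightarrow> f (vadd \<omega> \<omega>') = f (\<lambda>_. False)"
      using assms w(1) unfolding additive_on_def by blast
    then show "vadd \<omega> \<omega>' \<in> Omega es n \<and> f (vadd \<omega> \<omega>') = f (\<lambda>_. False)"
      using w assms(2) by (simp add: vadd_in_Omega)
  qed
  show "vadd \<omega> ` {d \<in> Omega es n. f d = f (\<lambda>_. False)} \<subseteq> {\<omega>' \<in> Omega es n. f \<omega>' = f \<omega>}"
  proof clarify
    fix d assume d: "d \<in> Omega es n" "f d = f (\<lambda>_. False)"
    then have "vadd \<omega> d \<in> Omega es n" using assms(2) by (simp add: vadd_in_Omega)
    then have "f \<omega> = f (vadd \<omega> d) \<longleftrightarrow> f (vadd \<omega> (vadd \<omega> d)) = f (\<lambda>_. False)"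
      using assms unfolding additive_on_def by blast
    then show "vadd \<omega> d \<in> Omega es n \<and> f (vadd \<omega> d) = f \<omega>"
      using d \<open>vadd \<omega> d \<in> Omega es n\<close> by simp
  qed
qed auto

lemma ent_additive:
  assumes "additive_on es n f"
  shows "ent es n f = real (length es) * real n - log 2 (real (card {d \<in> Omega es n. f d = f (\<lambda>_. False)}))"
proof -
  have "(\<Sum>\<omega>\<in>Omega es n. log 2 (fib es n f \<omega>))
     = (\<Sum>\<omega>\<in>Omega es n. log 2 (real (card {d \<in> Omega es n. f d = f (\<lambda>_. False)})))"
    unfolding fib_def
    by (intro sum.cong refl arg_cong[where f = "\<lambda>k. log 2 (real k)"] card_fibre_additive[OF assms])
  then show ?thesis
    by (simp add: ent_eq_fib log_card_Omega)
qed

text \<open>A coordinate projection is additive, and its kernel consists of the vectors supported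
  off \<open>T\<close>.\<close>

lemma ent_restr:
  assumes "T \<subseteq> Idx es n"
  shows "ent es n (restr T) = real (card T)"
proof -
  have "additive_on es n (restr T)"
    by (auto simp: additive_on_def restr_def vadd_def fun_eq_iff)
  moreover have "{d \<in> Omega es n. restr T d = restr T (\<lambda>_. False)} = supported (Idx es n - T)"
    using assms by (auto simp: Omega_def supported_def restr_def fun_eq_iff)
  moreover have "card T \<le> card (Idx es n)" "finite T"
    using assms card_mono[OF finite_Idx assms] finite_subset[OF assms] by simp_all
  ultimately show ?thesis
    using assms by (simp add: ent_additive card_supported log_nat_power card_Diff_subset card_Idx of_nat_diff)
qed

section \<open>Shearer and Fano inequalities, interactive communication\<close>

definition inc :: "nat set list \<Rightarrow> nat \<Rightarrow> nat set \<Rightarrow> (nat \<times> nat) set" where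
  "inc es n A = {x \<in> Idx es n. es ! fst x \<inter> A \<noteq> {}}"

text \<open>This is the single-letter entropy of \<open>X_A\<close>, by \<open>ent_XA\<close> at
  \<open>n = 1\<close>.\<close>

definition hits :: "nat set list \<Rightarrow> nat set \<Rightarrow> nat" where
  "hits es A = card {e. e < length es \<and> es ! e \<inter> A \<noteq> {}}"

lemma inc_subset: "inc es n A \<subseteq> Idx es n"
  by (auto simp: inc_def)

lemma card_inc: "card (inc es n A) = n * hits es A"
proof -
  have "inc es n A = {e. e < length es \<and> es ! e \<inter> A \<noteq> {}} \<times> {0..<n}"
    by (auto simp: inc_def Idx_def)
  then show ?thesis by (simp add: card_cartesian_product hits_def)
qed

lemma Xi_eq_restr: "Xi es n i = restr (inc es n {i})"
  by (auto simp: Xi_def restr_def inc_def fun_eq_iff)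

text \<open>\<open>XA\<close> stores a bit once for every terminal of \<open>A\<close> that sees it.
  The copies carry no information, so \<open>XA\<close> has the same fibres as one
  projection.\<close>

lemma XA_eq_iff: "XA es n A \<omega> = XA es n A \<omega>' \<longleftrightarrow> restr (inc es n A) \<omega> = restr (inc es n A) \<omega>'"
  (is "?l \<longleftrightarrow> ?r")
proof
  assume ?l
  then have *: "XA es n A \<omega> i x = XA es n A \<omega>' i x" for i x by simp
  show ?r
  proof
    fix x show "restr (inc es n A) \<omega> x = restr (inc es n A) \<omega>' x"
    proof (cases "x \<in> inc es n A")
      case True
      then obtain i where "i \<in> A" "i \<in> es ! fst x" "x \<in> Idx es n" by (auto simp: inc_def)
      with *[of i x] show ?thesis by (simp add: XA_def Xi_def restr_def)
    qed (simp add: restr_def)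
  qed
next
  assume ?r
  then have *: "restr (inc es n A) \<omega> x = restr (inc es n A) \<omega>' x" for x by simp
  show ?l
  proof (intro ext)
    fix i x show "XA es n A \<omega> i x = XA es n A \<omega>' i x"
      using *[of x] by (auto simp: XA_def Xi_def restr_def inc_def)
  qed
qed

lemma ent_XA: "ent es n (XA es n A) = real n * real (hits es A)"
proof -
  have "ent es n (XA es n A) = ent es n (restr (inc es n A))"
    by (rule ent_cong) (rule XA_eq_iff)
  then show ?thesis by (simp add: ent_restr inc_subset card_inc)
qed

lemma ent_Xi: "ent es n (Xi es n i) = real n * real (hits es {i})"
  by (simp add: Xi_eq_restr ent_restr inc_subset card_inc)

lemma cond_ent_XA_singleton:
  "cond_ent es n (XA es n {i}) L = ent es n (\<lambda>\<omega>. (Xi es n i \<omega>, L \<omega>)) - ent es n L"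
proof -
  have "ent es n (\<lambda>\<omega>. (XA es n {i} \<omega>, L \<omega>)) = ent es n (\<lambda>\<omega>. (Xi es n i \<omega>, L \<omega>))"
    by (rule ent_cong) (simp add: XA_eq_iff Xi_eq_restr)
  then show ?thesis by (simp add: cond_ent_eq)
qed

text \<open>Induction on \<open>U\<close>. A new point \<open>x\<close> raises the left side by
  \<open>t\<close> times its marginal gain over \<open>U\<close>; on the right, each of the
  \<open>t\<close> sets \<open>S i\<close> containing \<open>x\<close> gains at least as much, since
  marginal gains shrink as sets grow.\<close>

lemma shearer_submodular:
  fixes h :: "'a set \<Rightarrow> real"
  assumes "finite U" "finite I"
    and cover: "\<And>x. x \<in> U \<Longrightarrow> card {i \<in> I. x \<in> S i} = t"
    and submod: "\<And>A B x. A \<subseteq> B \<Longrightarrow> h (insert x B) - h B \<le> h (insert x A) - h A"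
  shows "real t * (h U - h {}) \<le> (\<Sum>i\<in>I. h (S i \<inter> U) - h {})"
  using assms(1) cover
proof (induction U rule: finite_induct)
  case (insert x U)
  let ?J = "{i \<in> I. x \<in> S i}"
  have t: "card ?J = t" by (rule insert.prems) simp
  have "real t * (h (insert x U) - h {})
      = real t * (h U - h {}) + (\<Sum>i\<in>?J. h (insert x U) - h U)"
    using t by (simp add: algebra_simps)
  also have "\<dots> \<le> (\<Sum>i\<in>I. h (S i \<inter> U) - h {}) + (\<Sum>i\<in>?J. h (insert x (S i \<inter> U)) - h (S i \<inter> U))"
    by (intro add_mono sum_mono submod insert.IH insert.prems) auto
  also have "\<dots> = (\<Sum>i\<in>I. h (S i \<inter> U) - h {} + (if x \<in> S i then h (insert x (S i \<inter> U)) - h (S i \<inter> U) else 0))"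
    using \<open>finite I\<close> by (simp add: sum.distrib sum.inter_filter)
  also have "\<dots> = (\<Sum>i\<in>I. h (S i \<inter> insert x U) - h {})"
    by (rule sum.cong) auto
  finally show ?case .
qed simp

text \<open>Diminishing returns for the entropy of a set of bits joined with a fixed
  \<open>V\<close>: submodularity for the bit \<open>x\<close> and the bits in \<open>B\<close>,
  conditioned on the bits in \<open>A\<close> and \<open>V\<close>.\<close>

lemma ent_restr_submodular:
  assumes "A \<subseteq> B"
  shows "ent es n (\<lambda>\<omega>. (restr (insert x B) \<omega>, V \<omega>)) - ent es n (\<lambda>\<omega>. (restr B \<omega>, V \<omega>))
    \<le> ent es n (\<lambda>\<omega>. (restr (insert x A) \<omega>, V \<omega>)) - ent es n (\<lambda>\<omega>. (restr A \<omega>, V \<omega>))"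
proof -
  let ?W = "\<lambda>\<omega>. (restr A \<omega>, V \<omega>)"
  have "ent es n (\<lambda>\<omega>. (restr {x} \<omega>, restr B \<omega>, ?W \<omega>)) = ent es n (\<lambda>\<omega>. (restr (insert x B) \<omega>, V \<omega>))"
    "ent es n (\<lambda>\<omega>. (restr {x} \<omega>, ?W \<omega>)) = ent es n (\<lambda>\<omega>. (restr (insert x A) \<omega>, V \<omega>))"
    "ent es n (\<lambda>\<omega>. (restr B \<omega>, ?W \<omega>)) = ent es n (\<lambda>\<omega>. (restr B \<omega>, V \<omega>))"
    by (rule ent_cong; use assms in \<open>auto simp: restr_def fun_eq_iff; blast\<close>)+
  then show ?thesis
    using ent_submodular[of es n "restr {x}" "restr B" ?W] by simp
qed

lemma finite_terminals [simp]: "finite (terminals m)"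
  by (simp add: terminals_def)

lemma card_terminals [simp]: "card (terminals m) = m"
  by (simp add: terminals_def)

lemma finite_partitions: "finite (partitions m)"
  by (rule finite_subset[of _ "Pow (Pow (terminals m))"]) (auto simp: partitions_def partition_on_def)

lemma partition_on_singletons: "partition_on A ((\<lambda>i. {i}) ` A)"
  by (auto simp: partition_on_def disjoint_def)

text \<open>The right side sums the mutual informations between each \<open>X_i\<close> and the
  first \<open>k\<close> transmissions. Induction on \<open>k\<close>: one more symbol adds the same
  amount to the left side and to the speaker's term, and lowers no other term.\<close>

lemma ent_take_le_sum_information:
  fixes F :: "outcome \<Rightarrow> nat list"
  assumes F: "\<forall>\<omega>\<in>Omega es n. length (F \<omega>) = r"
    and h: "\<forall>j<r. s j \<in> terminals m \<and> (\<exists>h. \<forall>\<omega>\<in>Omega es n. F \<omega> ! j = h (Xi es n (s j) \<omega>) (take j (F \<omega>)))"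
    and "k \<le> r"
  shows "ent es n (\<lambda>\<omega>. take k (F \<omega>)) \<le> (\<Sum>i\<in>terminals m. ent es n (Xi es n i)
     + ent es n (\<lambda>\<omega>. take k (F \<omega>)) - ent es n (\<lambda>\<omega>. (Xi es n i \<omega>, take k (F \<omega>))))"
  using \<open>k \<le> r\<close>
proof (induction k)
  case 0
  have "ent es n (\<lambda>\<omega>. (Xi es n i \<omega>, [] :: nat list)) = ent es n (Xi es n i)" for i
    by (rule ent_cong) simp
  then show ?case by simp
next
  case (Suc k)
  let ?G = "\<lambda>k \<omega>. take k (F \<omega>)"
  let ?D = "ent es n (?G (Suc k)) - ent es n (?G k)"
  let ?T = "\<lambda>k i. ent es n (Xi es n i) + ent es n (?G k) - ent es n (\<lambda>\<omega>. (Xi es n i \<omega>, ?G k \<omega>))"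
  from h Suc.prems have s: "s k \<in> terminals m"
    and ex: "\<exists>h. \<forall>\<omega>\<in>Omega es n. F \<omega> ! k = h (Xi es n (s k) \<omega>) (take k (F \<omega>))"
    by auto
  from ex obtain f where f: "\<forall>\<omega>\<in>Omega es n. F \<omega> ! k = f (Xi es n (s k) \<omega>) (take k (F \<omega>))" ..
  have G: "?G (Suc k) \<omega> = ?G k \<omega> @ [F \<omega> ! k]" if "\<omega> \<in> Omega es n" for \<omega>
    using F Suc.prems that by (simp add: take_Suc_conv_app_nth)
  have G_eq: "?G (Suc k) \<omega> = ?G (Suc k) \<omega>' \<longleftrightarrow> ?G k \<omega> = ?G k \<omega>' \<and> F \<omega> ! k = F \<omega>' ! k"
    if "\<omega> \<in> Omega es n" "\<omega>' \<in> Omega es n" for \<omega> \<omega>'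
    using G that by simp
  \<comment> \<open>The next symbol is a function of the speaker's observation and the past, so this
    joint entropy stays the same and the speaker's information grows by all of
    \<open>?D\<close>.\<close>
  have speaker: "ent es n (\<lambda>\<omega>. (Xi es n (s k) \<omega>, ?G (Suc k) \<omega>)) = ent es n (\<lambda>\<omega>. (Xi es n (s k) \<omega>, ?G k \<omega>))"
    by (rule ent_cong) (use G_eq f in auto)
  \<comment> \<open>A longer transcript cannot carry less information about
    \<open>X_i\<close>.\<close>
  have other: "?T k i \<le> ?T (Suc k) i" for i
  proof -
    have "ent es n (\<lambda>\<omega>. (Xi es n i \<omega>, ?G (Suc k) \<omega>, ?G k \<omega>)) + ent es n (?G k)
       \<le> ent es n (\<lambda>\<omega>. (Xi es n i \<omega>, ?G k \<omega>)) + ent es n (\<lambda>\<omega>. (?G (Suc k) \<omega>, ?G k \<omega>))"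
      by (rule ent_submodular)
    moreover have "ent es n (\<lambda>\<omega>. (Xi es n i \<omega>, ?G (Suc k) \<omega>, ?G k \<omega>)) = ent es n (\<lambda>\<omega>. (Xi es n i \<omega>, ?G (Suc k) \<omega>))"
      "ent es n (\<lambda>\<omega>. (?G (Suc k) \<omega>, ?G k \<omega>)) = ent es n (?G (Suc k))"
      by (rule ent_cong; use G_eq in auto)+
    ultimately show ?thesis by simp
  qed
  have "ent es n (?G (Suc k)) = ent es n (?G k) + ?D" by simp
  also have "\<dots> \<le> (\<Sum>i\<in>terminals m. ?T k i) + ?D" using Suc by simp
  also have "\<dots> = ?T k (s k) + ?D + (\<Sum>i\<in>terminals m - {s k}. ?T k i)"
    using s by (simp add: sum.remove[of _ "s k"])
  also have "\<dots> \<le> ?T (Suc k) (s k) + (\<Sum>i\<in>terminals m - {s k}. ?T (Suc k) i)"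
    using speaker by (intro add_mono sum_mono other) simp
  also have "\<dots> = (\<Sum>i\<in>terminals m. ?T (Suc k) i)"
    using s by (simp add: sum.remove[of _ "s k"])
  finally show ?case .
qed

lemma ent_comm_le_sum_information:
  assumes "interactive_comm m es n F"
  shows "ent es n F \<le> (\<Sum>i\<in>terminals m. ent es n (Xi es n i)
     + ent es n F - ent es n (\<lambda>\<omega>. (Xi es n i \<omega>, F \<omega>)))"
proof -
  obtain r s where F: "\<forall>\<omega>\<in>Omega es n. length (F \<omega>) = r"
    and h: "\<forall>j<r. s j \<in> terminals m \<and> (\<exists>h. \<forall>\<omega>\<in>Omega es n. F \<omega> ! j = h (Xi es n (s j) \<omega>) (take j (F \<omega>)))"
    using assms unfolding interactive_comm_def by blast
  have "ent es n (\<lambda>\<omega>. take r (F \<omega>)) = ent es n F"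
    "ent es n (\<lambda>\<omega>. (Xi es n i \<omega>, take r (F \<omega>))) = ent es n (\<lambda>\<omega>. (Xi es n i \<omega>, F \<omega>))" for i
    by (rule ent_cong; simp add: F)+
  then show ?thesis using ent_take_le_sum_information[OF F h order_refl] by simp
qed

text \<open>A form of Fano's inequality in which the entropy of the whole source replaces the
  log-size of the alphabet of \<open>K\<close>. Given \<open>V\<close> and the success flag,
  \<open>K\<close> is determined on success, and on failure a fibre contains at most all outcomes;
  the flag itself costs at most one bit.\<close>

lemma fano:
  assumes "Pr es n (\<lambda>\<omega>. d (V \<omega>) = K \<omega>) \<ge> 1 - \<epsilon>"
  shows "ent es n (\<lambda>\<omega>. (K \<omega>, V \<omega>)) \<le> ent es n V + 1 + \<epsilon> * (real (length es) * real n)"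
proof -
  let ?O = "Omega es n" and ?N = "real (card (Omega es n))"
  let ?E = "\<lambda>\<omega>. d (V \<omega>) = K \<omega>"
  let ?EV = "\<lambda>\<omega>. (?E \<omega>, V \<omega>)" and ?KV = "\<lambda>\<omega>. (K \<omega>, V \<omega>)"
  have N: "?N > 0" by simp
  have "(\<Sum>\<omega>\<in>?O. log 2 (fib es n ?EV \<omega>)) \<le> (\<Sum>\<omega>\<in>?O. log 2 (fib es n ?KV \<omega>) + (if ?E \<omega> then 0 else log 2 ?N))"
  proof (rule sum_mono)
    fix \<omega> assume w: "\<omega> \<in> ?O"
    show "log 2 (fib es n ?EV \<omega>) \<le> log 2 (fib es n ?KV \<omega>) + (if ?E \<omega> then 0 else log 2 ?N)"
    proof (cases "?E \<omega>")
      case True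
      then have "fib es n ?EV \<omega> \<le> fib es n ?KV \<omega>"
        by (intro fib_antimono) auto
      then show ?thesis using True fib_pos[OF w, of ?EV] fib_pos[OF w, of ?KV] by simp
    next
      case False
      have "log 2 (fib es n ?EV \<omega>) \<le> log 2 ?N"
        using fib_le_card[of es n ?EV \<omega>] fib_pos[OF w, of ?EV] by simp
      moreover have "0 \<le> log 2 (fib es n ?KV \<omega>)"
        using fib_pos[OF w, of ?KV] by (simp add: fib_def)
      ultimately show ?thesis using False by simp
    qed
  qed
  also have "\<dots> = (\<Sum>\<omega>\<in>?O. log 2 (fib es n ?KV \<omega>)) + real (card {\<omega>\<in>?O. \<not> ?E \<omega>}) * log 2 ?N"
    by (simp add: sum.distrib sum.If_cases Int_def Collect_neg_eq flip: Collect_neg_eq)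
  also have "real (card {\<omega>\<in>?O. \<not> ?E \<omega>}) * log 2 ?N \<le> (\<epsilon> * ?N) * log 2 ?N"
  proof (rule mult_right_mono)
    have "real (card ({\<omega>\<in>?O. ?E \<omega>} \<union> {\<omega>\<in>?O. \<not> ?E \<omega>})) = real (card {\<omega>\<in>?O. ?E \<omega>}) + real (card {\<omega>\<in>?O. \<not> ?E \<omega>})"
      by (subst card_Un_disjoint) auto
    also have "{\<omega>\<in>?O. ?E \<omega>} \<union> {\<omega>\<in>?O. \<not> ?E \<omega>} = ?O" by auto
    finally show "real (card {\<omega>\<in>?O. \<not> ?E \<omega>}) \<le> \<epsilon> * ?N"
      using assms N by (simp add: Pr_def field_simps)
  qed (simp add: log_card_Omega)
  finally have "(\<Sum>\<omega>\<in>?O. log 2 (fib es n ?EV \<omega>)) / ?N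
      \<le> ((\<Sum>\<omega>\<in>?O. log 2 (fib es n ?KV \<omega>)) + \<epsilon> * ?N * log 2 ?N) / ?N"
    using N by (intro divide_right_mono) auto
  also have "\<dots> = (\<Sum>\<omega>\<in>?O. log 2 (fib es n ?KV \<omega>)) / ?N + \<epsilon> * log 2 ?N"
    using N by (simp add: add_divide_distrib)
  finally have "ent es n ?KV \<le> ent es n ?EV + \<epsilon> * log 2 ?N"
    by (simp add: ent_eq_fib)
  moreover have "ent es n ?EV \<le> ent es n ?E + ent es n V" by (rule ent_pair_le)
  moreover have "ent es n ?E \<le> 1"
  proof -
    have "card (?E ` ?O) \<le> card (UNIV :: bool set)" by (rule card_mono) auto
    then have "log 2 (real (card (?E ` ?O))) \<le> log 2 2"
      by (subst log_le_cancel_iff) (auto simp: card_gt_0_iff)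
    then show ?thesis using ent_le_log_card[of es n ?E] by simp
  qed
  ultimately show ?thesis by (simp add: log_card_Omega)
qed

section \<open>Uniform hypergraphs: Shearer's inequality and the finite-length converse\<close>

locale uniform_pin =
  fixes m t :: nat and es :: "nat set list"
  assumes m_ge: "m \<ge> 2"
    and uniform: "\<forall>e\<in>set es. e \<subseteq> terminals m \<and> card e = t"
    and t_ge: "t \<ge> 2"
begin

lemma edge: "e < length es \<Longrightarrow> es ! e \<subseteq> terminals m \<and> card (es ! e) = t"
  using uniform by simp

lemma edge_nonempty: "e < length es \<Longrightarrow> es ! e \<noteq> {}"
  using edge[of e] t_ge by auto

text \<open>With an empty edge list nothing bounds \<open>t\<close> from above, hence the side
  condition.\<close>

lemma t_le: "es \<noteq> [] \<Longrightarrow> t \<le> m"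
  using edge[of 0] card_mono[of "terminals m" "es ! 0"] by simp

lemma hits_terminals: "hits es (terminals m) = length es"
proof -
  have "{e. e < length es \<and> es ! e \<inter> terminals m \<noteq> {}} = {..<length es}"
    using edge edge_nonempty by blast
  then show ?thesis by (simp add: hits_def)
qed

text \<open>Double counting of incident pairs of a terminal and a hyperedge.\<close>

lemma sum_hits: "(\<Sum>i\<in>terminals m. hits es {i}) = t * length es"
proof -
  have "(\<Sum>i\<in>terminals m. hits es {i}) = (\<Sum>i\<in>terminals m. \<Sum>e\<in>{e\<in>{..<length es}. i \<in> es ! e}. 1)"
    by (simp add: hits_def)
  also have "\<dots> = (\<Sum>e\<in>{..<length es}. \<Sum>i\<in>{i\<in>terminals m. i \<in> es ! e}. 1)"
    by (rule sum.swap_restrict) auto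
  also have "\<dots> = (\<Sum>e\<in>{..<length es}. t)"
  proof (rule sum.cong[OF refl])
    fix e assume "e \<in> {..<length es}"
    then have "{i\<in>terminals m. i \<in> es ! e} = es ! e" "card (es ! e) = t" using edge[of e] by auto
    then show "(\<Sum>i\<in>{i\<in>terminals m. i \<in> es ! e}. 1) = t" by simp
  qed
  finally show ?thesis by simp
qed

text \<open>No hyperedge is empty, so every bit is seen by some terminal and jointly the terminals
  know the outcome.\<close>

lemma inc_terminals: "inc es n (terminals m) = Idx es n"
  using edge edge_nonempty by (fastforce simp: inc_def Idx_def)

lemma restr_Idx: "\<omega> \<in> Omega es n \<Longrightarrow> restr (Idx es n) \<omega> = \<omega>"
  by (auto simp: restr_def Omega_def fun_eq_iff)

lemma XA_terminals_eq_iff: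
  "\<omega> \<in> Omega es n \<Longrightarrow> \<omega>' \<in> Omega es n \<Longrightarrow>
    XA es n (terminals m) \<omega> = XA es n (terminals m) \<omega>' \<longleftrightarrow> \<omega> = \<omega>'"
  by (simp add: XA_eq_iff inc_terminals restr_Idx)

lemma ent_XA_terminals: "ent es n (XA es n (terminals m)) = real (length es) * real n"
  by (simp add: ent_XA hits_terminals)

text \<open>The joint observation is injective on outcomes, so it can be inverted. This discharges
  the clause of \<open>is_CR\<close> and \<open>is_CIW\<close> that asks for functions of the
  source.\<close>

lemma fun_of_XA_terminals: "fun_of es n f (XA es n (terminals m))"
  unfolding fun_of_def
proof (intro exI ballI)
  let ?X = "XA es n (terminals m)"
  fix \<omega> assume "\<omega> \<in> Omega es n"
  moreover have "inj_on ?X (Omega es n)" using XA_terminals_eq_iff by (auto simp: inj_on_def)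
  ultimately show "f \<omega> = (f \<circ> inv_into (Omega es n) ?X) (?X \<omega>)" by simp
qed

lemma ent_injective:
  assumes "inj_on f (Omega es n)"
  shows "ent es n f = real (length es) * real n"
proof -
  have "ent es n f = ent es n (XA es n (terminals m))"
    by (rule ent_cong) (use assms XA_terminals_eq_iff in \<open>auto simp: inj_on_eq_iff\<close>)
  then show ?thesis by (simp add: ent_XA_terminals)
qed

lemma cond_ent_XA_terminals: "cond_ent es n (XA es n (terminals m)) L = real (length es) * real n - ent es n L"
  by (subst cond_ent_eq, subst ent_injective) (auto simp: inj_on_def XA_terminals_eq_iff)

text \<open>Instance of \<open>shearer_submodular\<close> in which \<open>S i\<close> is the set of
  bits seen by terminal \<open>i\<close>; each bit lies in exactly \<open>t\<close> of these sets,
  one for each member of its hyperedge.\<close>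

lemma shearer:
  "real t * (real (length es) * real n - ent es n V)
    \<le> (\<Sum>i\<in>terminals m. ent es n (\<lambda>\<omega>. (Xi es n i \<omega>, V \<omega>)) - ent es n V)"
proof -
  let ?h = "\<lambda>T. ent es n (\<lambda>\<omega>. (restr T \<omega>, V \<omega>))"
  have "real t * (?h (Idx es n) - ?h {}) \<le> (\<Sum>i\<in>terminals m. ?h (inc es n {i} \<inter> Idx es n) - ?h {})"
  proof (rule shearer_submodular)
    fix x assume x: "x \<in> Idx es n"
    then have "{i\<in>terminals m. x \<in> inc es n {i}} = es ! fst x" "card (es ! fst x) = t"
      using edge[of "fst x"] by (auto simp: inc_def Idx_def)
    then show "card {i\<in>terminals m. x \<in> inc es n {i}} = t" by simp
  qed (auto intro: ent_restr_submodular)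
  moreover have "?h (Idx es n) = real (length es) * real n"
    by (rule ent_injective) (auto simp: inj_on_def restr_Idx)
  moreover have "?h {} = ent es n V"
    by (rule ent_cong) (simp add: restr_def)
  moreover have "inc es n A \<inter> Idx es n = inc es n A" for A by (auto simp: inc_def)
  ultimately show ?thesis by (simp add: Xi_eq_restr)
qed

lemma singleton_in_partitions: "singleton_partition m \<in> partitions m"
  using m_ge by (simp add: partitions_def singleton_partition_def partition_on_singletons card_image)

lemma sum_singleton_partition: "(\<Sum>A\<in>singleton_partition m. f A) = (\<Sum>i\<in>terminals m. f {i})"
  unfolding singleton_partition_def by (subst sum.reindex) auto

lemma card_singleton_partition: "card (singleton_partition m) = m"
  by (simp add: singleton_partition_def card_image)

lemma Delta_singletons: "Delta es m (singleton_partition m) = (real t - 1) * real (length es) / (real m - 1)"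
proof -
  have "(\<Sum>i\<in>terminals m. real (hits es {i})) = real t * real (length es)"
    by (simp add: sum_hits flip: of_nat_sum)
  then show ?thesis
    by (simp add: Delta_def sum_singleton_partition card_singleton_partition ent_XA hits_terminals algebra_simps)
qed

lemma MMI_le: "P \<in> partitions m \<Longrightarrow> MMI es m \<le> Delta es m P"
  unfolding MMI_def by (rule Min_le) (auto simp: finite_partitions)

text \<open>The left factor \<open>ent es n K - mutual_info es n K F\<close> is H(K | F), in the
  form in which the secrecy bound will be used. The error term has one Fano loss per
  terminal.\<close>

lemma sk_converse_bound:
  assumes F: "interactive_comm m es n F"
    and g: "Pr es n (\<lambda>\<omega>. \<forall>i\<in>terminals m. g i (Xi es n i \<omega>) (F \<omega>) = K \<omega>) \<ge> 1 - \<epsilon>"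
  shows "(real m - real t) * (ent es n K - mutual_info es n K F)
     \<le> (real t - 1) * ent es n F + real m * (1 + \<epsilon> * (real (length es) * real n))"
proof -
  let ?N = "real (length es) * real n"
  let ?KF = "\<lambda>\<omega>. (K \<omega>, F \<omega>)"
  have fano_i: "ent es n (\<lambda>\<omega>. (Xi es n i \<omega>, ?KF \<omega>)) \<le> ent es n (\<lambda>\<omega>. (Xi es n i \<omega>, F \<omega>)) + 1 + \<epsilon> * ?N"
    if i: "i \<in> terminals m" for i
  proof -
    let ?V = "\<lambda>\<omega>. (Xi es n i \<omega>, F \<omega>)"
    have "card {\<omega>\<in>Omega es n. \<forall>i\<in>terminals m. g i (Xi es n i \<omega>) (F \<omega>) = K \<omega>}
        \<le> card {\<omega>\<in>Omega es n. case_prod (g i) (?V \<omega>) = K \<omega>}"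
      by (rule card_mono) (use i in auto)
    then have "Pr es n (\<lambda>\<omega>. case_prod (g i) (?V \<omega>) = K \<omega>) \<ge> 1 - \<epsilon>"
      using g unfolding Pr_def by (meson divide_right_mono of_nat_0_le_iff of_nat_le_iff order_trans)
    then have "ent es n (\<lambda>\<omega>. (K \<omega>, ?V \<omega>)) \<le> ent es n ?V + 1 + \<epsilon> * ?N" by (rule fano)
    moreover have "ent es n (\<lambda>\<omega>. (K \<omega>, ?V \<omega>)) = ent es n (\<lambda>\<omega>. (Xi es n i \<omega>, ?KF \<omega>))"
      by (rule ent_cong) auto
    ultimately show ?thesis by simp
  qed
  have "real t * (?N - ent es n ?KF) \<le> (\<Sum>i\<in>terminals m. ent es n (\<lambda>\<omega>. (Xi es n i \<omega>, ?KF \<omega>)) - ent es n ?KF)"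
    by (rule shearer)
  also have "\<dots> \<le> (\<Sum>i\<in>terminals m. ent es n (\<lambda>\<omega>. (Xi es n i \<omega>, F \<omega>)) + (1 + \<epsilon> * ?N) - ent es n ?KF)"
    using fano_i by (intro sum_mono) force
  also have "\<dots> = (\<Sum>i\<in>terminals m. ent es n (\<lambda>\<omega>. (Xi es n i \<omega>, F \<omega>))) + real m * (1 + \<epsilon> * ?N) - real m * ent es n ?KF"
    by (simp add: sum.distrib sum_subtractf)
  \<comment> \<open>Interactivity enters here. For arbitrary \<open>F\<close>, subadditivity would
    give only the coefficient \<open>real m\<close> in place of \<open>real m - 1\<close>.\<close>
  also have "(\<Sum>i\<in>terminals m. ent es n (\<lambda>\<omega>. (Xi es n i \<omega>, F \<omega>)))
      \<le> (\<Sum>i\<in>terminals m. ent es n (Xi es n i)) + (real m - 1) * ent es n F"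
    using ent_comm_le_sum_information[OF F] by (simp add: sum.distrib sum_subtractf algebra_simps)
  also have "(\<Sum>i\<in>terminals m. ent es n (Xi es n i)) = real t * ?N"
    by (simp add: ent_Xi sum_hits flip: of_nat_sum sum_distrib_left)
  finally show ?thesis
    by (simp add: mutual_info_def cond_ent_eq algebra_simps)
qed

end

section \<open>Common information, omniscience and the converse\<close>

text \<open>\<open>CIW_rate\<close> ranges over labels with values in \<open>nat\<close>; this codes
  the outcome itself as such a label.\<close>

lemma finite_inj_on_nat:
  assumes "finite A"
  shows "\<exists>f :: 'a \<Rightarrow> nat. inj_on f A"
  using finite_imp_inj_to_nat_seg[OF assms] by blast

locale type_S_pin = uniform_pin +
  assumes typeS: "typeS es m"
begin

lemma MMI_eq: "MMI es m = (real t - 1) * real (length es) / (real m - 1)"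
  using typeS Delta_singletons by (simp add: typeS_def)

text \<open>Type S puts the singleton partition among those over which \<open>cond_MMI\<close>
  maximises, and Shearer's inequality bounds its value from below by
  \<open>(real t - 1) / (real m - 1)\<close> times H(X | L).\<close>

lemma cond_MMI_ge:
  "(real t - 1) * (real (length es) * real n - ent es n L) \<le> (real m - 1) * cond_MMI es m n L"
proof -
  let ?S = "singleton_partition m"
  let ?v = "\<lambda>P. ((\<Sum>A\<in>P. cond_ent es n (XA es n A) L) - cond_ent es n (XA es n (terminals m)) L) / (real (card P) - 1)"
  have "?v ?S \<le> cond_MMI es m n L"
    unfolding cond_MMI_def
    by (rule Max_ge) (use typeS singleton_in_partitions in \<open>auto simp: finite_partitions typeS_def\<close>)
  then have "(\<Sum>A\<in>?S. cond_ent es n (XA es n A) L) - cond_ent es n (XA es n (terminals m)) L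
      \<le> (real m - 1) * cond_MMI es m n L"
    using m_ge by (simp add: card_singleton_partition pos_divide_le_eq mult.commute)
  moreover have "real t * (real (length es) * real n - ent es n L) \<le> (\<Sum>A\<in>?S. cond_ent es n (XA es n A) L)"
    using shearer[of n L] by (simp add: sum_singleton_partition cond_ent_XA_singleton)
  ultimately show ?thesis
    by (simp add: cond_ent_XA_terminals algebra_simps)
qed

lemma cond_MMI_injective:
  assumes "inj_on L (Omega es n)"
  shows "cond_MMI es m n L = 0"
proof -
  have "cond_ent es n f L = 0" for f :: "outcome \<Rightarrow> nat \<Rightarrow> outcome"
  proof -
    have "inj_on (\<lambda>\<omega>. (f \<omega>, L \<omega>)) (Omega es n)" using assms by (auto simp: inj_on_def)
    then show ?thesis using assms by (simp add: cond_ent_eq ent_injective)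
  qed
  \<comment> \<open>A minimizing partition must exist, so that the maximum is taken over
    \<open>{0}\<close> and not over the empty set.\<close>
  moreover have "singleton_partition m \<in> {P \<in> partitions m. Delta es m P = MMI es m}"
    using typeS singleton_in_partitions by (simp add: typeS_def)
  then have "(\<lambda>P. 0 :: real) ` {P \<in> partitions m. Delta es m P = MMI es m} = {0}" by blast
  ultimately show ?thesis by (simp add: cond_MMI_def)
qed

lemma CIW_lower_bound:
  assumes "is_CIW m es L"
    and rate: "\<forall>\<epsilon>>0. \<forall>\<^sub>F n in sequentially. ent es n (L n) / real n \<le> R + \<epsilon>"
  shows "real (length es) \<le> R"
proof (rule field_le_epsilon)
  fix \<epsilon> :: real assume \<epsilon>: "\<epsilon> > 0"
  \<comment> \<open>The factor for which H(X | L) is at most \<open>c\<close> times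
    \<open>cond_MMI\<close>; the divisor is positive because \<open>t \<ge> 2\<close>.\<close>
  define c where "c = (real m - 1) / (real t - 1)"
  have "(\<lambda>n. c * (cond_MMI es m n (L n) / real n)) \<longlonglongrightarrow> c * 0"
    using assms(1) unfolding is_CIW_def by (intro tendsto_mult tendsto_const) simp
  then have "\<forall>\<^sub>F n in sequentially. c * (cond_MMI es m n (L n) / real n) < \<epsilon> / 2"
    using \<epsilon> by (intro order_tendstoD) auto
  moreover have "\<forall>\<^sub>F n in sequentially. ent es n (L n) / real n \<le> R + \<epsilon> / 2"
    using rate \<epsilon> by simp
  ultimately have "\<forall>\<^sub>F n in sequentially. real (length es) \<le> R + \<epsilon>"
    using eventually_gt_at_top[of "0 :: nat"]
  proof eventually_elim
    case (elim n)
    have "real (length es) * real n - ent es n (L n) \<le> c * cond_MMI es m n (L n)"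
      using cond_MMI_ge[of n "L n"] t_ge by (simp add: c_def pos_le_divide_eq mult.commute)
    from divide_right_mono[OF this, of "real n"] have "real (length es) - ent es n (L n) / real n \<le> c * (cond_MMI es m n (L n) / real n)"
      using elim(3) by (simp add: diff_divide_distrib)
    with elim show ?case by linarith
  qed
  then show "real (length es) \<le> R + \<epsilon>" by simp
qed

lemma is_CIW_injective:
  assumes "\<And>n. inj_on (L n) (Omega es n)"
  shows "is_CIW m es L"
  using assms by (simp add: is_CIW_def fun_of_XA_terminals cond_MMI_injective)

lemma rate_injective:
  assumes "\<And>n. inj_on (L n) (Omega es n)" "\<epsilon> > 0"
  shows "\<forall>\<^sub>F n in sequentially. ent es n (L n) / real n \<le> real (length es) + \<epsilon>"
  using eventually_gt_at_top[of "0 :: nat"]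
  by eventually_elim (use assms in \<open>simp add: ent_injective\<close>)

text \<open>The bound \<open>CIW_lower_bound\<close> is attained by the source itself, coded in
  \<open>nat\<close>.\<close>

lemma CIW_rate_eq: "CIW_rate es m = real (length es)"
  unfolding CIW_rate_def
proof (rule cInf_eq_minimum)
  have "\<forall>n. \<exists>f :: outcome \<Rightarrow> nat. inj_on f (Omega es n)" by (simp add: finite_inj_on_nat)
  then obtain L :: "nat \<Rightarrow> outcome \<Rightarrow> nat" where "\<And>n. inj_on (L n) (Omega es n)" by metis
  then show "real (length es) \<in> {R. \<exists>L :: nat \<Rightarrow> outcome \<Rightarrow> nat. is_CIW m es L \<and>
      (\<forall>\<epsilon>>0. \<forall>\<^sub>F n in sequentially. ent es n (L n) / real n \<le> R + \<epsilon>)}"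
    using is_CIW_injective[of L] rate_injective[of L] by blast
qed (use CIW_lower_bound in blast)

text \<open>The bits are announced one after the other, each by some terminal of its hyperedge,
  without regard to the past.\<close>

lemma full_disclosure:
  obtains F where "interactive_comm m es n F" "inj_on F (Omega es n)"
proof
  let ?xs = "List.product [0..<length es] [0..<n]"
  let ?F = "\<lambda>\<omega>. map (\<lambda>x. if \<omega> x then 1 else 0 :: nat) ?xs"
  let ?s = "\<lambda>j. SOME i. i \<in> es ! fst (?xs ! j)"
  have idx: "set ?xs = Idx es n" by (simp add: Idx_def)
  have s: "?s j \<in> es ! fst (?xs ! j)" "?xs ! j \<in> Idx es n" if "j < length ?xs" for j
  proof -
    show "?xs ! j \<in> Idx es n" using nth_mem[OF that] idx by simp
    then have "es ! fst (?xs ! j) \<noteq> {}" by (intro edge_nonempty) (auto simp: Idx_def)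
    then show "?s j \<in> es ! fst (?xs ! j)" by (simp add: some_in_eq)
  qed
  show "interactive_comm m es n ?F"
    unfolding interactive_comm_def
  proof (intro exI conjI allI impI ballI)
    show "length (?F \<omega>) = length ?xs" for \<omega> by simp
    fix j assume j: "j < length ?xs"
    have "fst (?xs ! j) < length es" using s(2)[OF j] by (auto simp: Idx_def)
    then show "?s j \<in> terminals m" using s(1)[OF j] edge by blast
    show "?F \<omega> ! j = (\<lambda>y _. if y (?xs ! j) then 1 else 0) (Xi es n (?s j) \<omega>) (take j (?F \<omega>))" for \<omega>
      using s[OF j] j by (simp add: Xi_def)
  qed
  show "inj_on ?F (Omega es n)"
  proof (rule inj_onI, rule ext)
    fix \<omega> \<omega>' x assume w: "\<omega> \<in> Omega es n" "\<omega>' \<in> Omega es n" "?F \<omega> = ?F \<omega>'"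
    show "\<omega> x = \<omega>' x"
    proof (cases "x \<in> Idx es n")
      case True
      then have "(if \<omega> x then 1 else 0 :: nat) = (if \<omega>' x then 1 else 0)"
        using w(3) idx unfolding map_eq_conv by blast
      then show ?thesis by (simp split: if_splits)
    next
      case False
      then show ?thesis using w(1,2) unfolding Omega_def by blast
    qed
  qed
qed

lemma Pr_eq_1:
  assumes "\<And>\<omega>. \<omega> \<in> Omega es n \<Longrightarrow> P \<omega>"
  shows "Pr es n P = 1"
proof -
  have "{\<omega> \<in> Omega es n. P \<omega>} = Omega es n" using assms by blast
  then show ?thesis by (simp add: Pr_def)
qed

lemma CI_rate_eq: "CI_rate es m = real (length es)"
  unfolding CI_rate_def
proof (rule cInf_eq_minimum)
  have "\<forall>n. \<exists>F. interactive_comm m es n F \<and> inj_on F (Omega es n)"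
    using full_disclosure by metis
  then obtain F where F: "\<And>n. interactive_comm m es n (F n)" "\<And>n. inj_on (F n) (Omega es n)"
    by metis
  \<comment> \<open>Full disclosure already makes \<open>(J, F)\<close> injective, so a constant,
    which every terminal recovers trivially, serves as the common randomness.\<close>
  let ?J = "\<lambda>(_ :: nat) (_ :: outcome). 0 :: nat"
  have inj: "inj_on (\<lambda>\<omega>. (?J n \<omega>, F n \<omega>)) (Omega es n)" for n
    using F(2)[of n] by (auto simp: inj_on_def)
  have "is_CR m es ?J F"
    unfolding is_CR_def
  proof (intro conjI allI impI F fun_of_XA_terminals)
    fix \<epsilon> :: real assume "0 < \<epsilon> \<and> \<epsilon> < 1"
    then have "Pr es n (\<lambda>\<omega>. \<forall>i\<in>terminals m. (\<lambda>_ _ _. 0) i (Xi es n i \<omega>) (F n \<omega>) = ?J n \<omega>) \<ge> 1 - \<epsilon>" for n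
      by (simp add: Pr_eq_1)
    then show "\<forall>\<^sub>F n in sequentially. \<exists>g. Pr es n (\<lambda>\<omega>. \<forall>i\<in>terminals m. g i (Xi es n i \<omega>) (F n \<omega>) = ?J n \<omega>) \<ge> 1 - \<epsilon>"
      by (intro always_eventually allI exI)
  qed
  then show "real (length es) \<in> {R. \<exists>(J :: nat \<Rightarrow> outcome \<Rightarrow> nat) F. is_CR m es J F \<and>
      is_CIW m es (\<lambda>n \<omega>. (J n \<omega>, F n \<omega>)) \<and>
      (\<forall>\<epsilon>>0. \<forall>\<^sub>F n in sequentially. ent es n (\<lambda>\<omega>. (J n \<omega>, F n \<omega>)) / real n \<le> R + \<epsilon>)}"
    using is_CIW_injective[OF inj] rate_injective[OF inj] by blast
qed (use CIW_lower_bound[of "\<lambda>n \<omega>. (_ n \<omega>, _ n \<omega>)"] in blast)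

text \<open>The rate tuple H(X_i) - I(X). It lies in the omniscience region and has the minimal sum,
  so it serves both for \<open>R_CO\<close> and for the code below.\<close>

definition rate :: "nat \<Rightarrow> real" where
  "rate i = real (hits es {i}) - MMI es m"

lemma sum_rate: "(\<Sum>i\<in>terminals m. rate i) = (real m - real t) / (real m - 1) * real (length es)"
proof -
  have "(\<Sum>i\<in>terminals m. rate i) = real t * real (length es) - real m * MMI es m"
    by (simp add: rate_def sum_subtractf sum_hits flip: of_nat_sum)
  also have "\<dots> = (real m - real t) / (real m - 1) * real (length es)"
    using m_ge by (simp add: MMI_eq field_simps)
  finally show ?thesis .
qed

text \<open>Compare \<open>MMI\<close> with \<open>Delta\<close> at the partition that splits
  \<open>B\<close> into singletons and keeps the complement as one block; it has
  \<open>card B + 1\<close> blocks, so the denominator is \<open>card B\<close>. The left side is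
  H(X_B | X_C) for \<open>C\<close> the complement of \<open>B\<close>.\<close>

lemma omniscience_region:
  assumes "B \<noteq> {}" "B \<subset> terminals m"
  shows "real (length es) - real (hits es (terminals m - B)) \<le> (\<Sum>i\<in>B. rate i)"
proof -
  let ?C = "terminals m - B" and ?S = "(\<lambda>i. {i}) ` B"
  have fin: "finite B" using assms by (simp add: finite_subset[OF psubset_imp_subset])
  have C: "?C \<notin> ?S" using assms by auto
  have cardP: "card (insert ?C ?S) = card B + 1" using fin C by (simp add: card_image)
  have B: "card B > 0" using fin assms by (simp add: card_gt_0_iff)
  have "partition_on (terminals m) (insert ?C ?S)"
    using assms by (fastforce simp: partition_on_def disjoint_def)
  then have "insert ?C ?S \<in> partitions m" using cardP B by (simp add: partitions_def)
  then have "MMI es m \<le> Delta es m (insert ?C ?S)" by (rule MMI_le)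
  also have "(\<Sum>A\<in>insert ?C ?S. ent es 1 (XA es 1 A)) = real (hits es ?C) + (\<Sum>i\<in>B. real (hits es {i}))"
    using fin C by (simp add: ent_XA sum.reindex)
  then have "Delta es m (insert ?C ?S) = (real (hits es ?C) + (\<Sum>i\<in>B. real (hits es {i})) - real (length es)) / real (card B)"
    using cardP by (simp add: Delta_def ent_XA hits_terminals)
  finally have "real (card B) * MMI es m \<le> real (hits es ?C) + (\<Sum>i\<in>B. real (hits es {i})) - real (length es)"
    using B by (simp add: pos_le_divide_eq mult.commute)
  then show ?thesis by (simp add: rate_def sum_subtractf)
qed

lemma cond_ent_XA_complement:
  assumes "B \<subseteq> terminals m"
  shows "cond_ent es 1 (XA es 1 B) (XA es 1 (terminals m - B)) = real (length es) - real (hits es (terminals m - B))"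
proof -
  have "inj_on (\<lambda>\<omega>. (XA es 1 B \<omega>, XA es 1 (terminals m - B) \<omega>)) (Omega es 1)"
  proof (rule inj_onI)
    fix \<omega> \<omega>' assume w: "\<omega> \<in> Omega es 1" "\<omega>' \<in> Omega es 1"
      "(XA es 1 B \<omega>, XA es 1 (terminals m - B) \<omega>) = (XA es 1 B \<omega>', XA es 1 (terminals m - B) \<omega>')"
    have "XA es 1 (terminals m) v i = (if i \<in> B then XA es 1 B v i else XA es 1 (terminals m - B) v i)" for v i
      using assms by (auto simp: XA_def)
    then have "XA es 1 (terminals m) \<omega> = XA es 1 (terminals m) \<omega>'" using w(3) by (intro ext) simp
    then show "\<omega> = \<omega>'" using w XA_terminals_eq_iff by blast
  qed
  then show ?thesis by (simp add: cond_ent_eq ent_injective ent_XA)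
qed

text \<open>\<open>rate\<close> is feasible. For optimality, sum the constraints for the complements
  of single terminals: each \<open>R i\<close> occurs in \<open>m - 1\<close> of them.\<close>

lemma R_CO_eq: "R_CO es m = (real m - real t) / (real m - 1) * real (length es)"
  unfolding R_CO_def
proof (rule cInf_eq_minimum)
  show "(real m - real t) / (real m - 1) * real (length es) \<in> {\<Sum>i\<in>terminals m. R i |R.
      \<forall>B. B \<noteq> {} \<and> B \<subset> terminals m \<longrightarrow> cond_ent es 1 (XA es 1 B) (XA es 1 (terminals m - B)) \<le> (\<Sum>i\<in>B. R i)}"
  proof (intro CollectI exI[of _ rate] conjI allI impI sum_rate[symmetric])
    fix B assume B: "B \<noteq> {} \<and> B \<subset> terminals m"
    then show "cond_ent es 1 (XA es 1 B) (XA es 1 (terminals m - B)) \<le> (\<Sum>i\<in>B. rate i)"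
      using omniscience_region[of B] cond_ent_XA_complement[of B] by auto
  qed
next
  fix x assume "x \<in> {\<Sum>i\<in>terminals m. R i |R.
      \<forall>B. B \<noteq> {} \<and> B \<subset> terminals m \<longrightarrow> cond_ent es 1 (XA es 1 B) (XA es 1 (terminals m - B)) \<le> (\<Sum>i\<in>B. R i)}"
  then obtain R where x: "x = (\<Sum>i\<in>terminals m. R i)"
    and R: "\<And>B. B \<noteq> {} \<Longrightarrow> B \<subset> terminals m \<Longrightarrow> cond_ent es 1 (XA es 1 B) (XA es 1 (terminals m - B)) \<le> (\<Sum>i\<in>B. R i)"
    by blast
  have "real (length es) - real (hits es {i}) \<le> x - R i" if i: "i \<in> terminals m" for i
  proof -
    have "card (terminals m - {i}) \<noteq> 0" using i m_ge by simp
    then have "terminals m - {i} \<noteq> {}" by (metis card.empty)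
    moreover have "terminals m - {i} \<subset> terminals m" using i by blast
    ultimately have le: "cond_ent es 1 (XA es 1 (terminals m - {i})) (XA es 1 (terminals m - (terminals m - {i})))
        \<le> (\<Sum>i\<in>terminals m - {i}. R i)"
      by (rule R)
    have "terminals m - (terminals m - {i}) = {i}" using i by blast
    then show ?thesis
      using le i x by (subst (asm) cond_ent_XA_complement) (auto simp: sum_diff1)
  qed
  then have "(\<Sum>i\<in>terminals m. real (length es) - real (hits es {i})) \<le> (\<Sum>i\<in>terminals m. x - R i)"
    by (rule sum_mono)
  moreover have "(\<Sum>i\<in>terminals m. real (hits es {i})) = real t * real (length es)"
    by (simp add: sum_hits flip: of_nat_sum)
  ultimately have "(real m - real t) * real (length es) \<le> (real m - 1) * x"
    using x by (simp add: sum_subtractf algebra_simps)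
  then show "(real m - real t) / (real m - 1) * real (length es) \<le> x"
    using m_ge by (simp add: pos_divide_le_eq mult.commute)
qed

text \<open>Dividing \<open>sk_converse_bound\<close> by \<open>n\<close> gives
  \<open>(real m - real t) * MMI es m \<le> (real t - 1) * R\<close> in the limit. Inserting the
  value of \<open>MMI\<close> and cancelling \<open>real t - 1\<close> finishes. Without hyperedges
  the claim is \<open>0 \<le> R\<close>.\<close>

lemma SK_lower_bound:
  assumes "R \<ge> 0"
    and R: "\<And>\<epsilon>. \<epsilon> > 0 \<Longrightarrow> \<exists>(K :: nat \<Rightarrow> outcome \<Rightarrow> nat) F. is_SK m es K F \<and>
         (\<forall>\<^sub>F n in sequentially. log 2 (real (range_size es n (F n))) / real n \<le> R + \<epsilon> \<and>
            ent es n (K n) / real n \<ge> MMI es m - \<epsilon>)"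
  shows "(real m - real t) / (real m - 1) * real (length es) \<le> R"
proof (cases "es = []")
  case False
  then have tm: "t \<le> m" by (rule t_le)
  \<comment> \<open>The total coefficient of \<open>\<epsilon>\<close> at the end: two from the key
    rate and the leakage, one from the communication rate, one from the additive constant in Fano's
    inequality, one from the error probability.\<close>
  define c where "c = 2 * (real m - real t) + (real t - 1) + real m + real m * real (length es)"
  have "0 \<le> real m - real t" "0 \<le> real t - 1" "0 < real m" using tm t_ge m_ge by simp_all
  then have c: "c > 0"
    unfolding c_def by (intro add_pos_nonneg[of _ "real m * _"] add_nonneg_pos add_nonneg_nonneg) simp_all
  have "(real m - real t) * MMI es m \<le> (real t - 1) * R"
  proof (rule field_le_epsilon)
    fix \<eta> :: real assume \<eta>: "\<eta> > 0"
    \<comment> \<open>\<open>is_CR\<close> speaks only of error levels below 1, hence the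
      cap.\<close>
    define \<epsilon> where "\<epsilon> = min (1 / 2) (\<eta> / c)"
    have e: "0 < \<epsilon>" "\<epsilon> < 1" "c * \<epsilon> \<le> \<eta>"
      using \<eta> c by (auto simp: \<epsilon>_def min_def field_simps)
    obtain K :: "nat \<Rightarrow> outcome \<Rightarrow> nat" and F where SK: "is_SK m es K F"
      and ev: "\<forall>\<^sub>F n in sequentially. log 2 (real (range_size es n (F n))) / real n \<le> R + \<epsilon> \<and>
            ent es n (K n) / real n \<ge> MMI es m - \<epsilon>"
      using R[OF e(1)] by blast
    have "\<forall>\<^sub>F n in sequentially. mutual_info es n (K n) (F n) \<le> \<epsilon>"
      using SK e by (simp add: is_SK_def)
    moreover have "\<forall>\<^sub>F n in sequentially. \<exists>g.
        Pr es n (\<lambda>\<omega>. \<forall>i\<in>terminals m. g i (Xi es n i \<omega>) (F n \<omega>) = K n \<omega>) \<ge> 1 - \<epsilon>"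
      using SK e by (simp add: is_SK_def is_CR_def)
    \<comment> \<open>From here on the additive 1 in Fano's inequality is at most
      \<open>\<epsilon> * real n\<close>, and so is the leakage.\<close>
    moreover have "\<forall>\<^sub>F n in sequentially. real n \<ge> 1 / \<epsilon>"
      using filterlim_real_sequentially by (simp add: filterlim_at_top)
    ultimately have "\<forall>\<^sub>F n in sequentially. (real m - real t) * MMI es m \<le> (real t - 1) * R + \<eta>"
      using ev
    proof eventually_elim
      case (elim n)
      then obtain g where g: "Pr es n (\<lambda>\<omega>. \<forall>i\<in>terminals m. g i (Xi es n i \<omega>) (F n \<omega>) = K n \<omega>) \<ge> 1 - \<epsilon>"
        by blast
      have n: "real n > 0" "1 \<le> \<epsilon> * real n"
        using elim(3) e less_le_trans[of 0 "1 / \<epsilon>" "real n"] by (simp_all add: field_simps)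
      have "interactive_comm m es n (F n)" using SK by (simp add: is_SK_def is_CR_def)
      from sk_converse_bound[OF this g]
      have bound: "(real m - real t) * (ent es n (K n) - mutual_info es n (K n) (F n))
        \<le> (real t - 1) * ent es n (F n) + real m * (1 + \<epsilon> * (real (length es) * real n))" .
      have "ent es n (F n) \<le> log 2 (real (range_size es n (F n)))"
        unfolding range_size_def by (rule ent_le_log_card)
      also have "\<dots> \<le> (R + \<epsilon>) * real n" using elim n by (simp add: pos_divide_le_eq)
      finally have F: "(real t - 1) * ent es n (F n) \<le> (real t - 1) * ((R + \<epsilon>) * real n)"
        using t_ge by (intro mult_left_mono) auto
      have "(MMI es m - \<epsilon>) * real n \<le> ent es n (K n)" using elim n by (simp add: pos_le_divide_eq)
      then have "(MMI es m - 2 * \<epsilon>) * real n \<le> ent es n (K n) - mutual_info es n (K n) (F n)"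
        using elim(1,3) n e mult_left_mono[of 1 "real n" \<epsilon>] by (simp add: algebra_simps)
      then have "(real m - real t) * ((MMI es m - 2 * \<epsilon>) * real n)
          \<le> (real m - real t) * (ent es n (K n) - mutual_info es n (K n) (F n))"
        using tm by (intro mult_left_mono) auto
      also note bound
      also note F
      also have "real m * (1 + \<epsilon> * (real (length es) * real n)) \<le> real m * (\<epsilon> * real n + \<epsilon> * (real (length es) * real n))"
        using n by (intro mult_left_mono) auto
      finally have "real n * ((real m - real t) * (MMI es m - 2 * \<epsilon>))
          \<le> real n * ((real t - 1) * (R + \<epsilon>) + real m * (\<epsilon> + \<epsilon> * real (length es)))"
        by (simp add: algebra_simps)
      then have "(real m - real t) * (MMI es m - 2 * \<epsilon>)
          \<le> (real t - 1) * (R + \<epsilon>) + real m * (\<epsilon> + \<epsilon> * real (length es))"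
        using n by simp
      then have "(real m - real t) * MMI es m \<le> (real t - 1) * R + c * \<epsilon>"
        by (simp add: c_def algebra_simps)
      then show ?case using e by simp
    qed
    then show "(real m - real t) * MMI es m \<le> (real t - 1) * R + \<eta>" by simp
  qed
  then have "(real t - 1) * ((real m - real t) / (real m - 1) * real (length es)) \<le> (real t - 1) * R"
    by (simp add: MMI_eq mult_ac)
  then show ?thesis by (rule mult_left_le_imp_le) (use t_ge in simp)
qed (use assms in simp)

end

section \<open>Achievability by random parity checks\<close>

text \<open>Toggling \<open>x\<close> changes the parity, so it matches the even subsets with the
  odd ones.\<close>

lemma card_even_subsets:
  assumes "finite T" "x \<in> T" "y x"
  shows "2 * card {a \<in> Pow T. even (card {z \<in> a. y z})} = 2 ^ card T"
proof -
  let ?E = "{a \<in> Pow T. even (card {z \<in> a. y z})}"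
  let ?D = "{a \<in> Pow T. odd (card {z \<in> a. y z})}"
  define f where "f a = (if x \<in> a then a - {x} else insert x a)" for a
  have f: "f (f a) = a" "a \<subseteq> T \<Longrightarrow> f a \<subseteq> T" for a
    using \<open>x \<in> T\<close> by (auto simp: f_def)
  have flip: "even (card {z \<in> f a. y z}) \<longleftrightarrow> odd (card {z \<in> a. y z})" if "a \<subseteq> T" for a
  proof -
    have fin: "finite {z \<in> a - {x}. y z}" using finite_subset[OF that \<open>finite T\<close>] by simp
    have "{z \<in> insert x a. y z} = insert x {z \<in> a - {x}. y z}" using assms by auto
    then have "card {z \<in> insert x a. y z} = Suc (card {z \<in> a - {x}. y z})"
      using fin by simp
    then show ?thesis
      by (cases "x \<in> a") (simp_all add: f_def insert_absorb)
  qed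
  have "bij_betw f ?E ?D"
    by (rule bij_betw_byWitness[where f' = f]) (use f flip in auto)
  then have "card ?E = card ?D" by (rule bij_betw_same_card)
  moreover have "card (?E \<union> ?D) = card ?E + card ?D"
    using \<open>finite T\<close> by (intro card_Un_disjoint) auto
  moreover have "?E \<union> ?D = Pow T" by auto
  ultimately show ?thesis using \<open>finite T\<close> by (simp add: card_Pow)
qed

text \<open>Averaging over all subsets of \<open>T\<close>: a vector that is nonzero on
  \<open>T\<close> escapes exactly half of the checks, any other escapes all of them. The weights
  will carry the survival probability under the checks still to be chosen.\<close>

lemma exists_parity_check:
  assumes "finite W" "finite T" "\<And>d. d \<in> W \<Longrightarrow> w d \<ge> (0 :: real)"
  shows "\<exists>a\<subseteq>T. (\<Sum>d\<in>{d \<in> W. even (card {x \<in> a. d x})}. w d) \<le> (\<Sum>d\<in>W. (if \<exists>x\<in>T. d x then 1 / 2 else 1) * w d)"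
proof (rule ccontr)
  let ?C = "\<Sum>d\<in>W. (if \<exists>x\<in>T. d x then 1 / 2 else 1) * w d"
  let ?S = "\<lambda>a. \<Sum>d\<in>{d \<in> W. even (card {x \<in> a. d x})}. w d"
  assume "\<not> ?thesis"
  then have "(\<Sum>a\<in>Pow T. ?C) < (\<Sum>a\<in>Pow T. ?S a)"
    using \<open>finite T\<close> by (intro sum_strict_mono) (auto simp: not_le)
  also have "(\<Sum>a\<in>Pow T. ?S a) = (\<Sum>d\<in>W. \<Sum>a\<in>{a \<in> Pow T. even (card {x \<in> a. d x})}. w d)"
    by (rule sum.swap_restrict) (use assms in auto)
  also have "\<dots> = (\<Sum>d\<in>W. 2 ^ card T * ((if \<exists>x\<in>T. d x then 1 / 2 else 1) * w d))"
  proof (rule sum.cong[OF refl])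
    fix d assume "d \<in> W"
    show "(\<Sum>a\<in>{a \<in> Pow T. even (card {x \<in> a. d x})}. w d)
        = 2 ^ card T * ((if \<exists>x\<in>T. d x then 1 / 2 else 1) * w d)"
    proof (cases "\<exists>x\<in>T. d x")
      case True
      define c where "c = card {a \<in> Pow T. even (card {x \<in> a. d x})}"
      from True have "2 * c = 2 ^ card T"
        unfolding c_def using card_even_subsets[OF \<open>finite T\<close>] by blast
      then have "2 * real c = 2 ^ card T"
        by (metis of_nat_mult of_nat_numeral of_nat_power)
      then have "real c * w d = 2 ^ card T * (1 / 2 * w d)" by simp
      then show ?thesis using True by (simp only: sum_constant c_def if_True)
    next
      case False
      then have "{a \<in> Pow T. even (card {x \<in> a. d x})} = Pow T"
        by (auto intro!: even_iff_mod_2_eq_zero[THEN iffD2] simp: subset_iff) (metis (no_types, lifting) Collect_empty_eq card.empty mod_0)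
      then show ?thesis using False \<open>finite T\<close> by (simp add: card_Pow)
    qed
  qed
  also have "\<dots> = 2 ^ card T * ?C" by (simp add: sum_distrib_left)
  finally show False using \<open>finite T\<close> by (simp add: card_Pow)
qed

text \<open>Conditional expectations: a uniformly random parity check of terminal \<open>j\<close> detects a
  vector that is visible to \<open>j\<close> with probability 1/2, so the checks can be fixed one after the
  other without increasing the expected number of undetected vectors.\<close>

lemma exists_parity_checks:
  fixes T :: "'b \<Rightarrow> 'a set" and W :: "('a \<Rightarrow> bool) set"
  assumes "\<And>j. finite (T j)" "finite W"
  shows "\<exists>as. list_all2 (\<lambda>j a. a \<subseteq> T j) js as \<and>
    real (card {d \<in> W. \<forall>a\<in>set as. even (card {x \<in> a. d x})})
      \<le> (\<Sum>d\<in>W. \<Prod>j\<leftarrow>js. if \<exists>x\<in>T j. d x then 1 / 2 else 1)"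
  using assms(2)
proof (induction js arbitrary: W)
  case (Cons j js)
  let ?w = "\<lambda>d. \<Prod>j\<leftarrow>js. if \<exists>x\<in>T j. d x then 1 / 2 else (1 :: real)"
  have "?w d \<ge> 0" for d by (induction js) auto
  then obtain a where a: "a \<subseteq> T j"
      "(\<Sum>d\<in>{d \<in> W. even (card {x \<in> a. d x})}. ?w d) \<le> (\<Sum>d\<in>W. (if \<exists>x\<in>T j. d x then 1 / 2 else 1) * ?w d)"
    using exists_parity_check[OF Cons.prems assms(1), of ?w] by blast
  have "finite {d \<in> W. even (card {x \<in> a. d x})}" using Cons.prems by simp
  from Cons.IH[OF this] obtain as where as: "list_all2 (\<lambda>j a. a \<subseteq> T j) js as"
      "real (card {d \<in> {d \<in> W. even (card {x \<in> a. d x})}. \<forall>a\<in>set as. even (card {x \<in> a. d x})})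
        \<le> (\<Sum>d\<in>{d \<in> W. even (card {x \<in> a. d x})}. ?w d)"
    by blast
  have "{d \<in> {d \<in> W. even (card {x \<in> a. d x})}. \<forall>a\<in>set as. even (card {x \<in> a. d x})}
      = {d \<in> W. \<forall>a\<in>set (a # as). even (card {x \<in> a. d x})}" by auto
  then show ?case
    using a as by (intro exI[of _ "a # as"]) simp
qed simp

section \<open>Parity transcripts and the key as a position within a fibre\<close>

definition parity :: "(nat \<times> nat) set \<Rightarrow> outcome \<Rightarrow> nat" where
  "parity a \<omega> = card {x \<in> a. \<omega> x} mod 2"

text \<open>Positions where both vectors are one count in both parities and cancel modulo 2.\<close>

lemma parity_vadd:
  assumes "finite a"
  shows "parity a \<omega> = parity a \<omega>' \<longleftrightarrow> parity a (vadd \<omega> \<omega>') = 0"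
proof -
  let ?X = "{x \<in> a. \<omega> x \<and> \<not> \<omega>' x}" and ?Y = "{x \<in> a. \<not> \<omega> x \<and> \<omega>' x}" and ?Z = "{x \<in> a. \<omega> x \<and> \<omega>' x}"
  have "{x \<in> a. \<omega> x} = ?X \<union> ?Z" "{x \<in> a. \<omega>' x} = ?Y \<union> ?Z" "{x \<in> a. vadd \<omega> \<omega>' x} = ?X \<union> ?Y"
    by (auto simp: vadd_def)
  moreover have "card (?X \<union> ?Z) = card ?X + card ?Z" "card (?Y \<union> ?Z) = card ?Y + card ?Z"
    "card (?X \<union> ?Y) = card ?X + card ?Y"
    using assms by (intro card_Un_disjoint; auto)+
  ultimately show ?thesis
    unfolding parity_def by simp presburger
qed

definition parities :: "(nat \<times> nat) set list \<Rightarrow> outcome \<Rightarrow> nat list" where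
  "parities as \<omega> = map (\<lambda>a. parity a \<omega>) as"

lemma parities_vadd:
  assumes "\<forall>a\<in>set as. finite a"
  shows "parities as \<omega> = parities as \<omega>' \<longleftrightarrow> parities as (vadd \<omega> \<omega>') = parities as (\<lambda>_. False)"
proof -
  have "\<forall>a\<in>set as. parity a \<omega> = parity a \<omega>' \<longleftrightarrow> parity a (vadd \<omega> \<omega>') = 0"
    using assms parity_vadd by blast
  moreover have "parity a (\<lambda>_. False) = 0" for a by (simp add: parity_def)
  ultimately show ?thesis by (simp add: parities_def)
qed

lemma range_size_parities: "range_size es n (parities as) \<le> 2 ^ length as"
proof -
  have "parities as ` Omega es n \<subseteq> {xs. set xs \<subseteq> {0, 1} \<and> length xs = length as}"
    by (auto simp: parities_def parity_def)
  then have "card (parities as ` Omega es n) \<le> card {xs. set xs \<subseteq> {0, 1 :: nat} \<and> length xs = length as}"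
    by (intro card_mono finite_lists_length_eq) auto
  also have "\<dots> = 2 ^ length as" by (simp add: card_lists_length_eq numeral_2_eq_2)
  finally show ?thesis by (simp add: range_size_def)
qed

text \<open>Each check involves only bits that its sender sees, so the sender computes it from its
  own observation alone.\<close>

lemma interactive_comm_parities:
  assumes "list_all2 (\<lambda>j a. a \<subseteq> inc es n {j}) js as" "set js \<subseteq> terminals m"
  shows "interactive_comm m es n (parities as)"
  unfolding interactive_comm_def
proof (intro exI conjI allI impI ballI)
  show "length (parities as \<omega>) = length as" for \<omega> by (simp add: parities_def)
  fix l assume l: "l < length as"
  have len: "length js = length as" using assms(1) by (rule list_all2_lengthD)
  then show "js ! l \<in> terminals m" using l assms(2) nth_mem[of l js] by auto
  have "as ! l \<subseteq> inc es n {js ! l}" using assms(1) l by (simp add: list_all2_conv_all_nth)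
  then have "{x \<in> as ! l. Xi es n (js ! l) \<omega> x} = {x \<in> as ! l. \<omega> x}" for \<omega>
    by (auto simp: Xi_eq_restr restr_def)
  then show "parities as \<omega> ! l = (\<lambda>y _. parity (as ! l) y) (Xi es n (js ! l) \<omega>) (take l (parities as \<omega>))" for \<omega>
    using l by (simp add: parities_def parity_def)
qed

lemma prod_list_concat_replicate:
  fixes f :: "'a \<Rightarrow> real"
  shows "prod_list (map f (concat (map (\<lambda>j. replicate (k j) j) xs))) = (\<Prod>j\<leftarrow>xs. f j ^ k j)"
  by (induction xs) (simp_all add: prod_list_replicate)

lemma set_concat_replicate_subset: "set (concat (map (\<lambda>j. replicate (k j) j) xs)) \<subseteq> set xs"
  by (induction xs) auto

lemma length_concat_replicate:
  "length (concat (map (\<lambda>j. replicate (k j) j) xs)) = (\<Sum>j\<leftarrow>xs. k j)"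
  by (induction xs) simp_all

text \<open>Number the elements of each fibre from 0. Additivity makes all fibres equally large, so
  the range of numbers is the same for every value of \<open>F\<close>, which is the source of
  secrecy.\<close>

lemma fibre_index:
  assumes "additive_on es n F"
  obtains K :: "outcome \<Rightarrow> nat" where "inj_on (\<lambda>\<omega>. (K \<omega>, F \<omega>)) (Omega es n)"
    "K ` Omega es n \<subseteq> {0..<card {d \<in> Omega es n. F d = F (\<lambda>_. False)}}"
proof -
  let ?M = "\<lambda>y. {\<omega> \<in> Omega es n. F \<omega> = y}"
  have "\<forall>y. \<exists>h. bij_betw h (?M y) {0..<card (?M y)}"
    by (simp add: ex_bij_betw_finite_nat)
  then have "\<exists>h. \<forall>y. bij_betw (h y) (?M y) {0..<card (?M y)}" by (rule choice)
  then obtain h where h: "\<And>y. bij_betw (h y) (?M y) {0..<card (?M y)}" by blast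
  show thesis
  proof
    show "inj_on (\<lambda>\<omega>. (h (F \<omega>) \<omega>, F \<omega>)) (Omega es n)"
    proof (rule inj_onI)
      fix \<omega> \<omega>' assume w: "\<omega> \<in> Omega es n" "\<omega>' \<in> Omega es n" "(h (F \<omega>) \<omega>, F \<omega>) = (h (F \<omega>') \<omega>', F \<omega>')"
      have "inj_on (h (F \<omega>)) (?M (F \<omega>))" by (rule bij_betw_imp_inj_on[OF h])
      then show "\<omega> = \<omega>'" using w by (auto dest: inj_onD)
    qed
    show "(\<lambda>\<omega>. h (F \<omega>) \<omega>) ` Omega es n \<subseteq> {0..<card {d \<in> Omega es n. F d = F (\<lambda>_. False)}}"
    proof clarify
      fix \<omega> assume w: "\<omega> \<in> Omega es n"
      then have "h (F \<omega>) \<omega> \<in> {0..<card (?M (F \<omega>))}" using bij_betwE[OF h[of "F \<omega>"]] by blast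
      then show "h (F \<omega>) \<omega> \<in> {0..<card {d \<in> Omega es n. F d = F (\<lambda>_. False)}}"
        by (simp only: card_fibre_additive[OF assms w])
    qed
  qed
qed

lemma half_power_eq_powr: "(1 / 2 :: real) ^ k = 2 powr (- real k)"
  by (simp add: powr_minus powr_realpow power_one_over inverse_eq_divide)

section \<open>The omniscience code and the secret key extracted from it\<close>

context type_S_pin
begin

lemma hits_le: "hits es A \<le> length es"
proof -
  have "hits es A \<le> card {..<length es}"
    unfolding hits_def by (rule card_mono) auto
  then show ?thesis by simp
qed

lemma rate_nonneg:
  assumes "i \<in> terminals m"
  shows "rate i \<ge> 0"
proof -
  have "{i} \<noteq> terminals m"
  proof
    assume "{i} = terminals m"
    from arg_cong[OF this, of card] show False using m_ge by simp
  qed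
  then have "real (length es) - real (hits es (terminals m - {i})) \<le> rate i"
    using omniscience_region[of "{i}"] assms by auto
  then show ?thesis using hits_le[of "terminals m - {i}"] by simp
qed

text \<open>The number of parity bits that terminal \<open>i\<close> sends; \<open>\<delta>\<close>
  is the slack above its omniscience rate.\<close>

definition blocks :: "nat \<Rightarrow> real \<Rightarrow> nat \<Rightarrow> nat" where
  "blocks n \<delta> i = nat \<lceil>real n * (rate i + \<delta>)\<rceil>"

lemma blocks_bounds:
  assumes "i \<in> terminals m" "\<delta> > 0"
  shows "real n * (rate i + \<delta>) \<le> real (blocks n \<delta> i)" "real (blocks n \<delta> i) \<le> real n * (rate i + \<delta>) + 1"
proof -
  have "0 \<le> real n * (rate i + \<delta>)" using rate_nonneg[OF assms(1)] assms(2) by simp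
  then show "real n * (rate i + \<delta>) \<le> real (blocks n \<delta> i)" "real (blocks n \<delta> i) \<le> real n * (rate i + \<delta>) + 1"
    unfolding blocks_def by linarith+
qed

text \<open>The nonzero differences of two outcomes that some terminal cannot tell apart by its own
  observation. A code is free of errors once every such vector violates some check.\<close>

definition ambiguous :: "nat \<Rightarrow> outcome set" where
  "ambiguous n = {d \<in> Omega es n. d \<noteq> (\<lambda>_. False) \<and> (\<exists>i\<in>terminals m. \<forall>x\<in>inc es n {i}. \<not> d x)}"

text \<open>A union bound, sorted by the set \<open>B\<close> of terminals that see
  \<open>d\<close>. Such vectors vanish on all bits seen outside \<open>B\<close>, so by
  \<open>omniscience_region\<close> there are at most 2 to the power \<open>n\<close> times the rate
  sum over \<open>B\<close>. Each has a weight smaller by a further factor 2 to the power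
  \<open>- n * \<delta>\<close>, and there are at most \<open>2 ^ m\<close> sets
  \<open>B\<close>.\<close>

lemma ambiguous_weight:
  assumes "\<delta> > 0"
  shows "(\<Sum>d\<in>ambiguous n. \<Prod>j\<in>terminals m. (if \<exists>x\<in>inc es n {j}. d x then 1 / 2 else 1) ^ blocks n \<delta> j)
    \<le> 2 ^ m * 2 powr (- (real n * \<delta>))"
proof -
  let ?B = "\<lambda>d. {j \<in> terminals m. \<exists>x\<in>inc es n {j}. d x}"
  let ?w = "\<lambda>d. \<Prod>j\<in>terminals m. (if \<exists>x\<in>inc es n {j}. d x then 1 / 2 else 1 :: real) ^ blocks n \<delta> j"
  have fin: "finite (ambiguous n)" by (simp add: ambiguous_def)
  have w: "?w d = (1 / 2) ^ (\<Sum>j\<in>?B d. blocks n \<delta> j)" for d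
  proof -
    have "?w d = (\<Prod>j\<in>terminals m. if j \<in> ?B d then (1 / 2) ^ blocks n \<delta> j else 1)"
      by (rule prod.cong) auto
    also have "\<dots> = (\<Prod>j\<in>?B d. (1 / 2) ^ blocks n \<delta> j)"
      by (subst prod.inter_filter[symmetric]) auto
    finally show ?thesis by (simp add: power_sum)
  qed
  have part: "(\<Sum>d\<in>{d \<in> ambiguous n. ?B d = B}. ?w d) \<le> 2 powr (- (real n * \<delta>))" if B: "B \<in> ?B ` ambiguous n" for B
  proof -
    let ?C = "terminals m - B"
    from B obtain d0 where d0: "B = ?B d0" "d0 \<in> ambiguous n" by (rule imageE)
    \<comment> \<open>\<open>omniscience_region\<close> needs \<open>B\<close> proper and nonempty:
      some terminal sees nothing of \<open>d0\<close>, while a bit set in \<open>d0\<close> is seen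
      by the members of its hyperedge.\<close>
    have sub: "B \<subset> terminals m" using d0 by (auto simp: ambiguous_def)
    have "\<exists>x\<in>Idx es n. d0 x" using d0 by (auto simp: ambiguous_def Omega_def fun_eq_iff)
    then obtain x where x: "x \<in> Idx es n" "d0 x" by blast
    then obtain j where j: "j \<in> es ! fst x" "j \<in> terminals m"
      using edge[of "fst x"] edge_nonempty[of "fst x"] by (fastforce simp: Idx_def)
    have "x \<in> inc es n {j}" using x j by (simp add: inc_def)
    then have ne: "B \<noteq> {}" using d0 x j by blast
    have finB: "finite B" using sub by (auto intro: finite_subset)
    have "{d \<in> ambiguous n. ?B d = B} \<subseteq> supported (Idx es n - inc es n ?C)"
      by (fastforce simp: ambiguous_def supported_def Omega_def inc_def)
    then have "card {d \<in> ambiguous n. ?B d = B} \<le> card (supported (Idx es n - inc es n ?C))"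
      by (intro card_mono finite_supported) auto
    also have "\<dots> = 2 ^ (length es * n - n * hits es ?C)"
      by (simp add: card_supported card_Diff_subset inc_subset finite_subset[OF inc_subset] card_Idx card_inc)
    finally have "real (card {d \<in> ambiguous n. ?B d = B}) \<le> real (2 ^ (length es * n - n * hits es ?C))"
      by (simp only: of_nat_le_iff)
    also have "\<dots> = 2 powr real (length es * n - n * hits es ?C)" by (simp add: powr_realpow)
    also have "real (length es * n - n * hits es ?C) = real n * (real (length es) - real (hits es ?C))"
      using mult_le_mono2[OF hits_le[of ?C], of n] by (simp add: of_nat_diff mult.commute right_diff_distrib)
    also have "2 powr (real n * (real (length es) - real (hits es ?C))) \<le> 2 powr (real n * (\<Sum>i\<in>B. rate i))"
      using omniscience_region[OF ne sub] by (intro powr_mono mult_left_mono) auto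
    finally have num: "real (card {d \<in> ambiguous n. ?B d = B}) \<le> 2 powr (real n * (\<Sum>i\<in>B. rate i))" .
    have "card B \<ge> 1" using ne finB by (simp add: Suc_le_eq card_gt_0_iff)
    then have "real n * \<delta> \<le> real n * (real (card B) * \<delta>)"
      using assms mult_right_mono[of 1 "real (card B)" \<delta>] by (intro mult_left_mono) auto
    then have "real n * (\<Sum>i\<in>B. rate i) + real n * \<delta> \<le> (\<Sum>i\<in>B. real n * (rate i + \<delta>))"
      by (simp add: sum.distrib algebra_simps sum_distrib_left)
    also have "\<dots> \<le> (\<Sum>i\<in>B. real (blocks n \<delta> i))"
      using sub assms by (intro sum_mono blocks_bounds) auto
    finally have exponent: "real n * (\<Sum>i\<in>B. rate i) + real n * \<delta> \<le> real (\<Sum>i\<in>B. blocks n \<delta> i)" by simp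
    have "(\<Sum>d\<in>{d \<in> ambiguous n. ?B d = B}. ?w d) = (\<Sum>d\<in>{d \<in> ambiguous n. ?B d = B}. (1 / 2) ^ (\<Sum>j\<in>B. blocks n \<delta> j))"
      by (rule sum.cong[OF refl]) (simp add: w)
    also have "\<dots> = real (card {d \<in> ambiguous n. ?B d = B}) * 2 powr (- real (\<Sum>j\<in>B. blocks n \<delta> j))"
      by (simp only: sum_constant half_power_eq_powr)
    also have "\<dots> \<le> 2 powr (real n * (\<Sum>i\<in>B. rate i)) * 2 powr (- (real n * (\<Sum>i\<in>B. rate i) + real n * \<delta>))"
      using num exponent by (intro mult_mono powr_mono) auto
    also have "\<dots> = 2 powr (- (real n * \<delta>))"
      by (simp add: powr_add[symmetric])
    finally show ?thesis .
  qed
  have "(\<Sum>d\<in>ambiguous n. ?w d) = (\<Sum>B\<in>?B ` ambiguous n. \<Sum>d\<in>{d \<in> ambiguous n. ?B d = B}. ?w d)"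
    by (rule sum.image_gen[OF fin])
  also have "\<dots> \<le> (\<Sum>B\<in>?B ` ambiguous n. 2 powr (- (real n * \<delta>)))"
    by (rule sum_mono) (rule part)
  also have "\<dots> \<le> (\<Sum>B\<in>Pow (terminals m). 2 powr (- (real n * \<delta>)))"
    by (rule sum_mono2) auto
  also have "\<dots> = 2 ^ m * 2 powr (- (real n * \<delta>))" by (simp add: card_Pow)
  finally show ?thesis .
qed

text \<open>With terminal \<open>i\<close> sending \<open>blocks n \<delta> i\<close> checks,
  \<open>ambiguous_weight\<close> bounds the number of undetected ambiguous vectors below 1, so
  there are none and every terminal recovers the outcome without error.\<close>

lemma omniscience_code:
  assumes "\<delta> > 0" "2 ^ m * 2 powr (- (real n * \<delta>)) < (1 :: real)"
  shows "\<exists>F. interactive_comm m es n F \<and> additive_on es n F \<and>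
    range_size es n F \<le> 2 ^ (\<Sum>i\<in>terminals m. blocks n \<delta> i) \<and>
    (\<forall>i\<in>terminals m. inj_on (\<lambda>\<omega>. (Xi es n i \<omega>, F \<omega>)) (Omega es n))"
proof -
  let ?k = "blocks n \<delta>"
  obtain xs where terms: "set xs = terminals m" and distinct: "distinct xs"
    using finite_distinct_list[OF finite_terminals] by blast
  define js where "js = concat (map (\<lambda>j. replicate (?k j) j) xs)"
  have js: "set js \<subseteq> terminals m" unfolding js_def terms[symmetric] by (rule set_concat_replicate_subset)
  have len: "length js = (\<Sum>i\<in>terminals m. ?k i)"
    unfolding js_def terms[symmetric] length_concat_replicate
    by (rule sum.distinct_set_conv_list[OF distinct, symmetric])
  have fin: "finite (inc es n {j})" for j by (rule finite_subset[OF inc_subset]) simp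
  have "finite (ambiguous n)" by (simp add: ambiguous_def)
  from exists_parity_checks[where T = "\<lambda>j. inc es n {j}" and js = js, OF fin this]
  obtain as where as: "list_all2 (\<lambda>j a. a \<subseteq> inc es n {j}) js as"
    "real (card {d \<in> ambiguous n. \<forall>a\<in>set as. even (card {x \<in> a. d x})})
      \<le> (\<Sum>d\<in>ambiguous n. \<Prod>j\<leftarrow>js. if \<exists>x\<in>inc es n {j}. d x then 1 / 2 else 1)"
    by (elim exE conjE) (rule that)
  have "(\<Prod>j\<leftarrow>js. if \<exists>x\<in>inc es n {j}. d x then 1 / 2 else 1 :: real)
      = (\<Prod>j\<in>terminals m. (if \<exists>x\<in>inc es n {j}. d x then 1 / 2 else 1) ^ ?k j)" for d
    unfolding js_def prod_list_concat_replicate terms[symmetric]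
    by (rule prod.distinct_set_conv_list[OF distinct, symmetric])
  with as(2) have "real (card {d \<in> ambiguous n. \<forall>a\<in>set as. even (card {x \<in> a. d x})}) < 1"
    using ambiguous_weight[OF assms(1), of n] assms(2) by simp
  then have none: "{d \<in> ambiguous n. \<forall>a\<in>set as. even (card {x \<in> a. d x})} = {}"
    by (simp add: ambiguous_def)
  have fas: "\<forall>a\<in>set as. finite a"
  proof
    fix a assume "a \<in> set as"
    then obtain l where "l < length as" "a = as ! l" by (auto simp: in_set_conv_nth)
    then have "a \<subseteq> inc es n {js ! l}" using as(1) by (simp add: list_all2_conv_all_nth)
    then show "finite a" by (rule finite_subset) (rule fin)
  qed
  \<comment> \<open>Two outcomes that terminal \<open>i\<close> confuses would differ by an
    ambiguous vector that passes all checks.\<close>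
  have "inj_on (\<lambda>\<omega>. (Xi es n i \<omega>, parities as \<omega>)) (Omega es n)" if i: "i \<in> terminals m" for i
  proof (rule inj_onI, rule ccontr)
    fix \<omega> \<omega>' assume w: "\<omega> \<in> Omega es n" "\<omega>' \<in> Omega es n"
      "(Xi es n i \<omega>, parities as \<omega>) = (Xi es n i \<omega>', parities as \<omega>')" and "\<omega> \<noteq> \<omega>'"
    have "vadd \<omega> \<omega>' \<noteq> (\<lambda>_. False)" using \<open>\<omega> \<noteq> \<omega>'\<close> by (auto simp: vadd_def fun_eq_iff)
    moreover have "\<forall>x\<in>inc es n {i}. \<not> vadd \<omega> \<omega>' x"
      using w(3) by (auto simp: Xi_eq_restr restr_def vadd_def fun_eq_iff)
    ultimately have "vadd \<omega> \<omega>' \<in> ambiguous n"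
      using w i by (auto simp: ambiguous_def vadd_in_Omega)
    moreover have "\<forall>a\<in>set as. even (card {x \<in> a. vadd \<omega> \<omega>' x})"
      using w(3) parity_vadd fas by (auto simp: parities_def parity_def even_iff_mod_2_eq_zero)
    ultimately show False using none by blast
  qed
  moreover have "additive_on es n (parities as)"
    using parities_vadd[OF fas] unfolding additive_on_def by blast
  moreover have "range_size es n (parities as) \<le> 2 ^ (\<Sum>i\<in>terminals m. ?k i)"
    using range_size_parities[of es n as] list_all2_lengthD[OF as(1)] len by simp
  ultimately show ?thesis
    using interactive_comm_parities[OF as(1) js] by blast
qed

lemma length_eq_MMI_plus_R_CO: "real (length es) = MMI es m + R_CO es m"
proof -
  have "MMI es m + R_CO es m = ((real t - 1) * real (length es) + (real m - real t) * real (length es)) / (real m - 1)"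
    by (simp add: MMI_eq R_CO_eq add_divide_distrib)
  also have "(real t - 1) * real (length es) + (real m - real t) * real (length es) = (real m - 1) * real (length es)"
    by (simp add: algebra_simps)
  finally show ?thesis using m_ge by simp
qed

text \<open>The transcript takes about R_CO of the |E| bits per source symbol, and the position
  within its fibre keeps the remaining rate, which is \<open>MMI\<close> by
  \<open>length_eq_MMI_plus_R_CO\<close>.\<close>

lemma SK_achievable:
  assumes "\<epsilon> > 0"
  shows "\<exists>(K :: nat \<Rightarrow> outcome \<Rightarrow> nat) F. is_SK m es K F \<and>
         (\<forall>\<^sub>F n in sequentially. log 2 (real (range_size es n (F n))) / real n \<le> R_CO es m + \<epsilon> \<and>
            ent es n (K n) / real n \<ge> MMI es m - \<epsilon>)"
proof -
  \<comment> \<open>The slack of the \<open>m\<close> terminals then totals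
    \<open>\<epsilon> / 2\<close>; the other half absorbs the rounding, one bit per terminal, once
    \<open>n \<ge> 2 * m / \<epsilon>\<close>.\<close>
  define \<delta> where "\<delta> = \<epsilon> / (2 * real m)"
  have \<delta>: "\<delta> > 0" using assms m_ge by (simp add: \<delta>_def)
  let ?L = "\<lambda>n. \<Sum>i\<in>terminals m. blocks n \<delta> i"
  let ?good = "\<lambda>n F. range_size es n F \<le> 2 ^ ?L n \<and>
    (\<forall>i\<in>terminals m. inj_on (\<lambda>\<omega>. (Xi es n i \<omega>, F \<omega>)) (Omega es n))"
  let ?big = "\<lambda>n. 2 ^ m * 2 powr (- (real n * \<delta>)) < (1 :: real)"
  \<comment> \<open>\<open>is_CR\<close> asks for a communication at every \<open>n\<close>, and
    \<open>fibre_index\<close> for additivity, so the empty transcript fills in for small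
    \<open>n\<close>.\<close>
  have "\<exists>F. interactive_comm m es n F \<and> additive_on es n F \<and> (?big n \<longrightarrow> ?good n F)" for n
  proof (cases "?big n")
    case True
    then show ?thesis using omniscience_code[OF \<delta>] by blast
  next
    case False
    have "interactive_comm m es n (\<lambda>_. [])" unfolding interactive_comm_def by (rule exI[of _ 0]) simp
    moreover have "additive_on es n (\<lambda>_. [] :: nat list)" by (simp add: additive_on_def)
    ultimately show ?thesis using False by blast
  qed
  then have "\<exists>F. \<forall>n. interactive_comm m es n (F n) \<and> additive_on es n (F n) \<and> (?big n \<longrightarrow> ?good n (F n))"
    by (intro choice allI)
  then obtain F where F: "\<And>n. interactive_comm m es n (F n)" "\<And>n. additive_on es n (F n)"
    "\<And>n. ?big n \<Longrightarrow> ?good n (F n)" by blast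
  let ?ker = "\<lambda>n. {d \<in> Omega es n. F n d = F n (\<lambda>_. False)}"
  have "\<exists>K :: outcome \<Rightarrow> nat. inj_on (\<lambda>\<omega>. (K \<omega>, F n \<omega>)) (Omega es n) \<and> K ` Omega es n \<subseteq> {0..<card (?ker n)}" for n
    by (rule fibre_index[OF F(2)]) blast
  then have "\<exists>K :: nat \<Rightarrow> outcome \<Rightarrow> nat. \<forall>n. inj_on (\<lambda>\<omega>. (K n \<omega>, F n \<omega>)) (Omega es n) \<and> K n ` Omega es n \<subseteq> {0..<card (?ker n)}"
    by (intro choice allI)
  then obtain K :: "nat \<Rightarrow> outcome \<Rightarrow> nat" where K: "\<And>n. inj_on (\<lambda>\<omega>. (K n \<omega>, F n \<omega>)) (Omega es n)"
    "\<And>n. K n ` Omega es n \<subseteq> {0..<card (?ker n)}" by blast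
  have "(\<lambda>n. 2 ^ m * 2 powr (- (real n * \<delta>))) \<longlonglongrightarrow> 2 ^ m * (0 :: real)"
  proof (intro tendsto_mult tendsto_const)
    have "(\<lambda>n. (2 powr - \<delta>) ^ n) \<longlonglongrightarrow> (0 :: real)"
      using \<delta> by (intro LIMSEQ_realpow_zero) (auto simp: powr_less_one)
    then show "(\<lambda>n. 2 powr (- (real n * \<delta>))) \<longlonglongrightarrow> (0 :: real)"
      by (simp add: powr_power mult.commute)
  qed
  from order_tendstoD(2)[OF this, of 1] have big: "\<forall>\<^sub>F n in sequentially. ?big n" by simp
  \<comment> \<open>H(K) is at most the log of the kernel size, and H(K | F) equals it, since
    \<open>(K, F)\<close> determines the outcome. The leakage vanishes at every
    \<open>n\<close>.\<close>
  have secret: "mutual_info es n (K n) (F n) \<le> 0" for n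
  proof -
    have "(\<lambda>_. False) \<in> ?ker n" by simp
    then have "?ker n \<noteq> {}" by blast
    then have ker: "card (?ker n) > 0" by (simp only: card_gt_0_iff) simp
    have "ent es n (K n) \<le> log 2 (real (card (K n ` Omega es n)))" by (rule ent_le_log_card)
    also have "\<dots> \<le> log 2 (real (card (?ker n)))"
      using card_mono[OF _ K(2)[of n]] ker by (subst log_le_cancel_iff) (auto simp: card_gt_0_iff)
    finally show ?thesis
      using K(1)[of n] F(2)[of n] by (simp add: mutual_info_def cond_ent_eq ent_injective ent_additive)
  qed
  have "is_CR m es K F"
    unfolding is_CR_def
  proof (intro conjI allI impI F(1) fun_of_XA_terminals)
    fix \<epsilon>' :: real assume e: "0 < \<epsilon>' \<and> \<epsilon>' < 1"
    show "\<forall>\<^sub>F n in sequentially. \<exists>g. Pr es n (\<lambda>\<omega>. \<forall>i\<in>terminals m. g i (Xi es n i \<omega>) (F n \<omega>) = K n \<omega>) \<ge> 1 - \<epsilon>'"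
      using big
    proof eventually_elim
      case (elim n)
      \<comment> \<open>The decoder first recovers the whole outcome from its observation and the
        transcript, then evaluates \<open>K\<close>.\<close>
      let ?g = "\<lambda>i x f. K n (inv_into (Omega es n) (\<lambda>\<omega>. (Xi es n i \<omega>, F n \<omega>)) (x, f))"
      have "?g i (Xi es n i \<omega>) (F n \<omega>) = K n \<omega>" if "i \<in> terminals m" "\<omega> \<in> Omega es n" for i \<omega>
        using F(3)[OF elim] that inv_into_f_f[of "\<lambda>\<omega>. (Xi es n i \<omega>, F n \<omega>)" "Omega es n" \<omega>] by simp
      then have "Pr es n (\<lambda>\<omega>. \<forall>i\<in>terminals m. ?g i (Xi es n i \<omega>) (F n \<omega>) = K n \<omega>) = 1"
        by (intro Pr_eq_1) blast
      then show ?case using e by (intro exI[of _ ?g]) simp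
    qed
  qed
  moreover have "\<forall>\<^sub>F n in sequentially. mutual_info es n (K n) (F n) \<le> \<epsilon>'" if "\<epsilon>' > 0" for \<epsilon>'
    using order_trans[OF secret less_imp_le[OF that]] by (intro always_eventually allI)
  ultimately have "is_SK m es K F" by (simp add: is_SK_def)
  moreover have "\<forall>\<^sub>F n in sequentially. real n \<ge> 2 * real m / \<epsilon>"
    using filterlim_real_sequentially by (simp add: filterlim_at_top)
  with big eventually_gt_at_top[of "0 :: nat"]
  have "\<forall>\<^sub>F n in sequentially. log 2 (real (range_size es n (F n))) / real n \<le> R_CO es m + \<epsilon> \<and>
            ent es n (K n) / real n \<ge> MMI es m - \<epsilon>"
  proof eventually_elim
    case (elim n)
    have "range_size es n (F n) > 0" by (simp add: range_size_def card_gt_0_iff)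
    moreover have "real (range_size es n (F n)) \<le> real (2 ^ ?L n)"
      using F(3)[OF elim(1)] by (simp only: of_nat_le_iff)
    ultimately have "log 2 (real (range_size es n (F n))) \<le> log 2 (real (2 ^ ?L n))"
      by (subst log_le_cancel_iff) auto
    also have "\<dots> = (\<Sum>i\<in>terminals m. real (blocks n \<delta> i))" by (simp add: log_nat_power)
    also have "\<dots> \<le> (\<Sum>i\<in>terminals m. real n * (rate i + \<delta>) + 1)"
      by (intro sum_mono blocks_bounds \<delta>)
    also have "\<dots> = real n * R_CO es m + real n * \<epsilon> / 2 + real m"
      using m_ge by (simp add: sum.distrib distrib_left R_CO_eq sum_rate \<delta>_def flip: sum_distrib_left)
    also have "real m \<le> real n * \<epsilon> / 2" using elim(3) assms by (simp add: field_simps)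
    finally have L: "log 2 (real (range_size es n (F n))) \<le> real n * (R_CO es m + \<epsilon>)"
      by (simp add: algebra_simps)
    have "real (length es) * real n \<le> ent es n (K n) + ent es n (F n)"
      using ent_pair_le[of es n "K n" "F n"] K(1)[of n] by (simp add: ent_injective)
    also have "ent es n (F n) \<le> real n * (R_CO es m + \<epsilon>)"
      using ent_le_log_card[of es n "F n"] L by (simp add: range_size_def)
    also have "real (length es) = MMI es m + R_CO es m" by (rule length_eq_MMI_plus_R_CO)
    finally have "real n * (MMI es m - \<epsilon>) \<le> ent es n (K n)" by (simp add: algebra_simps)
    then show ?case using L elim(2) by (simp add: pos_divide_le_eq pos_le_divide_eq mult.commute)
  qed
  ultimately show ?thesis by blast
qed

lemma R_SK_eq: "R_SK es m = R_CO es m"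
  unfolding R_SK_def
proof (rule cInf_eq_minimum)
  \<comment> \<open>\<open>R_SK\<close> admits only nonnegative rates; \<open>R_CO\<close> is a sum
    of nonnegative ones.\<close>
  have "0 \<le> R_CO es m"
    unfolding R_CO_eq sum_rate[symmetric] by (intro sum_nonneg rate_nonneg)
  then show "R_CO es m \<in> {R. R \<ge> 0 \<and> (\<forall>\<epsilon>>0. \<exists>(K :: nat \<Rightarrow> outcome \<Rightarrow> nat) F. is_SK m es K F \<and>
         (\<forall>\<^sub>F n in sequentially. log 2 (real (range_size es n (F n))) / real n \<le> R + \<epsilon> \<and>
            ent es n (K n) / real n \<ge> MMI es m - \<epsilon>))}"
    using SK_achievable by blast
qed (use SK_lower_bound in \<open>auto simp: R_CO_eq\<close>)

end

theorem theorem2: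
  fixes m t :: nat and es :: "nat set list"
  assumes "m \<ge> 2"
    and "\<forall>e \<in> set es. e \<subseteq> terminals m \<and> card e = t"
    and "t \<ge> 2"
    and "typeS es m"
  shows "CI_rate es m = CIW_rate es m \<and>
         CIW_rate es m = ent es 1 (XA es 1 (terminals m)) \<and>
         ent es 1 (XA es 1 (terminals m)) = real (length es) \<and>
         R_SK es m = R_CO es m \<and>
         R_CO es m = (real m - real t) / (real m - 1) * real (length es)"
proof -
  interpret type_S_pin m t es
    using assms by unfold_locales
  show ?thesis
    by (simp add: CI_rate_eq CIW_rate_eq ent_XA_terminals R_SK_eq R_CO_eq del: One_nat_def)
qed

end
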